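(* Suppose that strong duality and dual strict complementarity hold for the primal SDP (P) and the dual SDP (D). Let $(\bar X^\star,\bar y^\star,\bar Z^\star)$ be a triple of primal and dual optimal solutions satisfying dual strict complementarity. Let $f_{\mathrm D}(y,Z)=-\langle b,y\rangle+h(Z)$, where $h:\mathbb S^n\to\mathbb R\cup\{+\infty\}$ is either the indicator function $h=\delta_{\mathbb S^n_+}$ or the exact penalty function $h(Z)=\rho\max\{0,\lambda_{\max}(-Z)\}$ with $\rho>\mathrm{tr}(\bar X^\star)$. Then for any compact set $\mathcal V\subseteq\mathbb R^m\times\mathbb S^n$ containing an optimal solution $(y^\star,Z^\star)\in\Omega_{\mathrm D}$, there exist constants $\kappa,\gamma,\alpha>0$ such that $$f_{\mathrm D}(y,Z)-(-d^\star)+\gamma\|C-\mathcal A^*(y)-Z\|\ \ge\ \kappa\cdot\mathrm{dist}^2((y,Z),\Omega_{\mathrm D}),\qquad\forall (y,Z)\in\mathcal V,$$ $$d^\star-\langle b,y\rangle+\gamma\|C-\mathcal A^*(y)-Z\|+\alpha\cdot\mathrm{dist}(Z,\mathbb S^n_+)\ \ge\ \kappa\cdot\mathrm{dist}^2((y,Z),\Omega_{\mathrm D}),\qquad\forall (y,Z)\in\mathcal V.$$ If, in addition, $\Omega_{\mathrm D}$ is compact, then the set $\mathcal V$ can be chosen as any sublevel set $\{(y,Z)\in\mathbb R^m\times\mathbb S^n\mid f_{\mathrm D}(y,Z)\le\beta,\ \mathcal A^*(y)+Z=C\}$ with $\beta$ finite.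
   Context: $\mathbb S^n$ is the space of real symmetric $n\times n$ matrices with inner product $\langle X,Y\rangle=\mathrm{tr}(XY)$ and Frobenius norm $\|\cdot\|$; $\mathbb S^n_+$ is the cone of positive semidefinite matrices; $\mathbb R^m$ carries the Euclidean norm and $\mathbb R^m\times\mathbb S^n$ the norm $\|(y,Z)\|^2=\|y\|^2+\|Z\|^2$; $\mathrm{dist}$ is the distance with respect to these norms. $\delta_S$ is the indicator function of $S$ ($0$ on $S$, $+\infty$ elsewhere). Data: $C\in\mathbb S^n$, $b\in\mathbb R^m$, $A_1,\dots,A_m\in\mathbb S^n$, $\mathcal A:\mathbb S^n\to\mathbb R^m$, $\mathcal A(X)=(\langle A_1,X\rangle,\dots,\langle A_m,X\rangle)^{\mathsf T}$, with adjoint $\mathcal A^*(y)=\sum_i y_iA_i$. Standing assumption: $\mathcal A$ is surjective (equivalently, $A_1,\dots,A_m$ are linearly independent). (P): $p^\star=\min_{X\in\mathbb S^n}\langle C,X\rangle$ subject to $\mathcal A(X)=b$, $X\in\mathbb S^n_+$. (D): $d^\star=\max_{y\in\mathbb R^m,Z\in\mathbb S^n}\langle b,y\rangle$ subject to $\mathcal A^*(y)+Z=C$, $Z\in\mathbb S^n_+$. $\Omega_{\mathrm P}=\{X\in\mathbb S^n_+\mid\langle C,X\rangle=p^\star,\mathcal A(X)=b\}$ and $\Omega_{\mathrm D}=\{(y,Z)\in\mathbb R^m\times\mathbb S^n_+\mid\langle b,y\rangle=d^\star,\mathcal A^*(y)+Z=C\}$ are the optimal solution sets. Strong duality means $p^\star=d^\star$.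 A triple with $X^\star\in\Omega_{\mathrm P}$, $(y^\star,Z^\star)\in\Omega_{\mathrm D}$ satisfies dual strict complementarity if $X^\star\in\mathrm{relint}\big(\mathcal N_{(\mathbb S^n_+)^\circ}(-Z^\star)\big)$, where $(\mathbb S^n_+)^\circ=-\mathbb S^n_+$ is the polar cone, $\mathcal N$ denotes the normal cone and $\mathrm{relint}$ the relative interior. (P) and (D) satisfy dual strict complementarity if at least one such triple exists. *)

theory Defs
  imports "HOL-Analysis.Analysis"
begin

text \<open>
  Symmetric matrices form a subspace of \<open>real ^ 'n ^ 'n\<close>. The library norm on this type is the
  Frobenius norm, and the library inner product \<open>X \<bullet> Y\<close> (the sum of the entrywise products) is
  the trace inner product on symmetric matrices; see \<open>inner_eq_trace\<close> below. The library norm on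
  products is \<open>norm (y, Z) = sqrt ((norm y)\<^sup>2 + (norm Z)\<^sup>2)\<close>, and \<open>infdist\<close> is the distance to a
  (nonempty) set.
\<close>

definition sym_mats :: "(real ^ 'n ^ 'n) set" where
  "sym_mats = {X. transpose X = X}"

lemma inner_eq_trace:
  fixes X Y :: "real ^ 'n ^ 'n"
  assumes "X \<in> sym_mats"
  shows "X \<bullet> Y = trace (X ** Y)"
proof -
  have "X $ i $ j = X $ j $ i" for i j
    using assms by (metis (mono_tags) mem_Collect_eq sym_mats_def transpose_def vec_lambda_beta)
  then have "X \<bullet> Y = (\<Sum>i\<in>UNIV. \<Sum>j\<in>UNIV. X $ j $ i * Y $ i $ j)"
    by (simp add: inner_vec_def)
  also have "\<dots> = (\<Sum>j\<in>UNIV. \<Sum>i\<in>UNIV. X $ j $ i * Y $ i $ j)"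
    by (rule sum.swap)
  also have "\<dots> = trace (X ** Y)"
    by (simp add: trace_def matrix_matrix_mult_def)
  finally show ?thesis .
qed

definition psd_cone :: "(real ^ 'n ^ 'n) set" where
  "psd_cone = {X \<in> sym_mats. \<forall>v. 0 \<le> v \<bullet> (X *v v)}"

text \<open>For symmetric \<open>X\<close> the set of real eigenvalues is finite and nonempty, so \<open>Max\<close> is meaningful.\<close>

definition lambda_max :: "real ^ 'n ^ 'n \<Rightarrow> real" where
  "lambda_max X = Max {l. \<exists>v. v \<noteq> 0 \<and> X *v v = l *\<^sub>R v}"

text \<open>Polar and normal cones are taken in the ambient Euclidean space \<open>sym_mats\<close>.\<close>

definition polar_cone :: "(real ^ 'n ^ 'n) set \<Rightarrow> (real ^ 'n ^ 'n) set" where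
  "polar_cone K = {V \<in> sym_mats. \<forall>X\<in>K. V \<bullet> X \<le> 0}"

definition normal_cone :: "(real ^ 'n ^ 'n) set \<Rightarrow> real ^ 'n ^ 'n \<Rightarrow> (real ^ 'n ^ 'n) set" where
  "normal_cone K X = {V \<in> sym_mats. X \<in> K \<and> (\<forall>Y\<in>K. V \<bullet> (Y - X) \<le> 0)}"

definition opA :: "('m \<Rightarrow> real ^ 'n ^ 'n) \<Rightarrow> real ^ 'n ^ 'n \<Rightarrow> real ^ 'm" where
  "opA A X = (\<chi> i. A i \<bullet> X)"

definition adjA :: "('m \<Rightarrow> real ^ 'n ^ 'n) \<Rightarrow> real ^ 'm \<Rightarrow> real ^ 'n ^ 'n" where
  "adjA A y = (\<Sum>i\<in>UNIV. y $ i *\<^sub>R A i)"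

text \<open>
  The optimal values are extended reals, so that they are defined for infeasible or unbounded
  problems as well; they are attained exactly when the solution sets below are nonempty.
\<close>

definition primal_value ::
    "('m::finite \<Rightarrow> real ^ 'n ^ 'n) \<Rightarrow> real ^ 'm \<Rightarrow> real ^ 'n ^ 'n \<Rightarrow> ereal" where
  "primal_value A b C = (INF X\<in>{X \<in> psd_cone. opA A X = b}. ereal (C \<bullet> X))"

definition dual_value ::
    "('m::finite \<Rightarrow> real ^ 'n ^ 'n) \<Rightarrow> real ^ 'm \<Rightarrow> real ^ 'n ^ 'n \<Rightarrow> ereal" where
  "dual_value A b C = (SUP (y, Z)\<in>{(y, Z). Z \<in> psd_cone \<and> adjA A y + Z = C}. ereal (b \<bullet> y))"

definition primal_solutions ::
    "('m::finite \<Rightarrow> real ^ 'n ^ 'n) \<Rightarrow> real ^ 'm \<Rightarrow> real ^ 'n ^ 'n \<Rightarrow> (real ^ 'n ^ 'n) set" where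
  "primal_solutions A b C =
     {X \<in> psd_cone. ereal (C \<bullet> X) = primal_value A b C \<and> opA A X = b}"

definition dual_solutions ::
    "('m::finite \<Rightarrow> real ^ 'n ^ 'n) \<Rightarrow> real ^ 'm \<Rightarrow> real ^ 'n ^ 'n
       \<Rightarrow> ((real ^ 'm) \<times> (real ^ 'n ^ 'n)) set" where
  "dual_solutions A b C =
     {(y, Z). Z \<in> psd_cone \<and> ereal (b \<bullet> y) = dual_value A b C \<and> adjA A y + Z = C}"

definition strong_duality ::
    "('m::finite \<Rightarrow> real ^ 'n ^ 'n) \<Rightarrow> real ^ 'm \<Rightarrow> real ^ 'n ^ 'n \<Rightarrow> bool" where
  "strong_duality A b C \<longleftrightarrow> primal_value A b C = dual_value A b C"

definition dual_strict_compl_triple ::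
    "('m::finite \<Rightarrow> real ^ 'n ^ 'n) \<Rightarrow> real ^ 'm \<Rightarrow> real ^ 'n ^ 'n
       \<Rightarrow> real ^ 'n ^ 'n \<Rightarrow> real ^ 'm \<Rightarrow> real ^ 'n ^ 'n \<Rightarrow> bool" where
  "dual_strict_compl_triple A b C X y Z \<longleftrightarrow>
     X \<in> primal_solutions A b C \<and> (y, Z) \<in> dual_solutions A b C \<and>
     X \<in> rel_interior (normal_cone (polar_cone psd_cone) (- Z))"

definition dual_strict_complementarity ::
    "('m::finite \<Rightarrow> real ^ 'n ^ 'n) \<Rightarrow> real ^ 'm \<Rightarrow> real ^ 'n ^ 'n \<Rightarrow> bool" where
  "dual_strict_complementarity A b C \<longleftrightarrow> (\<exists>X y Z. dual_strict_compl_triple A b C X y Z)"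

definition indicator_fun :: "'a set \<Rightarrow> 'a \<Rightarrow> ereal" where
  "indicator_fun S x = (if x \<in> S then 0 else \<infinity>)"

definition exact_penalty :: "real \<Rightarrow> real ^ 'n ^ 'n \<Rightarrow> ereal" where
  "exact_penalty \<rho> Z = ereal (\<rho> * max 0 (lambda_max (- Z)))"

definition dual_objective ::
    "real ^ 'm \<Rightarrow> (real ^ 'n ^ 'n \<Rightarrow> ereal) \<Rightarrow> real ^ 'm \<Rightarrow> real ^ 'n ^ 'n \<Rightarrow> ereal" where
  "dual_objective b h y Z = ereal (- (b \<bullet> y)) + h Z"

end

theory Submission
  imports Defs
begin

text \<open>
  Write \<open>X\<close>, \<open>Z\<close> for the strictly complementary optimal pair and \<open>R = C - adjA A y - Z'\<close> for the
  residual at a point \<open>(y, Z')\<close>. Strong duality turns the dual gap into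
  \<open>dual_value - b \<bullet> y = X \<bullet> Z' + X \<bullet> R\<close> (\<open>duality_gap\<close>), so up to a multiple of \<open>norm R\<close> the
  quantity to be bounded from below is \<open>X \<bullet> Z'\<close>.

  Strict complementarity says that \<open>X\<close> is positive definite on the kernel of \<open>Z\<close>: if \<open>P\<close> is the
  orthogonal projection onto the range of \<open>Z\<close>, then \<open>Z\<close> dominates a positive multiple of \<open>P\<close>, \<open>X\<close>
  dominates a positive multiple of \<open>mat 1 - P\<close>, and \<open>X \<bullet> P = 0\<close>
  (\<open>strict_complementarity_projection\<close>). Two estimates follow.

  First, for positive semidefinite \<open>W\<close> the distance from \<open>W\<close> to its compression \<open>P ** W ** P\<close> is at
  most of order \<open>sqrt (norm W * (X \<bullet> W))\<close> (\<open>compression_error\<close>). The off-diagonal block of \<open>W\<close> is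
  controlled only by the square root of its diagonal block, and this is where the square of the
  distance comes from.

  Second, a positive semidefinite \<open>W\<close> with \<open>P ** W ** P = W\<close> is orthogonal to \<open>X\<close>, so such a \<open>W\<close>
  yields a dual solution once the linear equation holds. The equation can be repaired at a cost
  linear in the residual, because \<open>Z\<close> is an interior point of this face: solve the equation inside the
  linear span of the face and mix with a little of \<open>Z\<close> to restore semidefiniteness
  (\<open>face_error_bound\<close>).

  Together, on bounded sets the squared distance to the dual solutions is at most a constant times
  \<open>norm R + norm (Z' - W) + X \<bullet> W\<close> for every bounded positive semidefinite \<open>W\<close>
  (\<open>squared_distance_bound\<close>). The choice of \<open>W\<close> as nearest point of the cone gives the inequality with
  \<open>infdist\<close>; the choice \<open>W = Z' + l *\<^sub>R mat 1\<close>, where \<open>l = max 0 (lambda_max (- Z'))\<close>, gives the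
  inequality with the penalty, since \<open>X \<bullet> W = X \<bullet> Z' + l * trace X\<close> and the penalty
  \<open>\<rho> * l\<close> exceeds \<open>l * trace X\<close> by a multiple of \<open>l\<close>. The indicator function dominates every penalty.

  Finally, if the dual solutions form a bounded set, growth on a ball around them forces linear growth
  outside by convexity along segments to \<open>Z\<close>, so sublevel sets are bounded
  (\<open>bounded_penalty_sublevel\<close>).
\<close>

section \<open>Quadratic forms and the semidefinite cone\<close>

definition outer :: "real ^ 'n \<Rightarrow> real ^ 'n \<Rightarrow> real ^ 'n ^ 'n" where
  "outer v w = (\<chi> i j. v $ i * w $ j)"

lemma inner_outer: "outer v w \<bullet> M = v \<bullet> (M *v w)"
  by (simp add: outer_def inner_vec_def matrix_vector_mult_def sum_distrib_left mult_ac)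

lemma outer_mult_vec: "outer v w *v x = (w \<bullet> x) *\<^sub>R v"
  by (simp add: outer_def vec_eq_iff inner_vec_def matrix_vector_mult_def sum_distrib_left
      sum_distrib_right mult_ac)

lemma norm_outer: "norm (outer v v) = (norm v)\<^sup>2"
proof -
  have "(norm (outer v v))\<^sup>2 = ((norm v)\<^sup>2)\<^sup>2"
    by (simp add: power2_norm_eq_inner inner_outer outer_mult_vec) (simp add: power2_eq_square)
  then show ?thesis using power2_eq_imp_eq by fastforce
qed

lemma quad_form_abs_le:
  fixes v :: "real ^ 'n"
  shows "\<bar>v \<bullet> (M *v v)\<bar> \<le> norm M * (norm v)\<^sup>2"
  using Cauchy_Schwarz_ineq2[of "outer v v" M] by (simp add: inner_outer norm_outer mult.commute)

lemma sym_mats_iff: "X \<in> sym_mats \<longleftrightarrow> transpose X = X"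
  by (simp add: sym_mats_def)

lemma sym_mats_closed:
  "X \<in> sym_mats \<Longrightarrow> Y \<in> sym_mats \<Longrightarrow> X + Y \<in> sym_mats"
  "X \<in> sym_mats \<Longrightarrow> Y \<in> sym_mats \<Longrightarrow> X - Y \<in> sym_mats"
  "X \<in> sym_mats \<Longrightarrow> - X \<in> sym_mats"
  "X \<in> sym_mats \<Longrightarrow> c *\<^sub>R X \<in> sym_mats"
  "0 \<in> sym_mats" "mat 1 \<in> sym_mats" "outer v v \<in> sym_mats"
  by (simp_all add: sym_mats_def transpose_def vec_eq_iff mat_def outer_def mult.commute)

lemma sym_mats_dot: "X \<in> sym_mats \<Longrightarrow> v \<bullet> (X *v w) = w \<bullet> (X *v v)"
  by (metis dot_lmul_matrix inner_commute sym_mats_iff transpose_matrix_vector)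

lemma mult_vec_simps:
  fixes X Y :: "real ^ 'n ^ 'm"
  shows "(X + Y) *v v = X *v v + Y *v v" "(X - Y) *v v = X *v v - Y *v v"
    "(- X) *v v = - (X *v v)" "(c *\<^sub>R X) *v v = c *\<^sub>R (X *v v)" "0 *v v = (0 :: real ^ 'm)"
    "X *v (c *\<^sub>R v) = c *\<^sub>R (X *v v)"
  by (simp_all add: matrix_vector_mult_def vec_eq_iff sum.distrib sum_subtractf sum_negf
      sum_distrib_left algebra_simps)

lemma psd_coneD: "X \<in> psd_cone \<Longrightarrow> X \<in> sym_mats" "X \<in> psd_cone \<Longrightarrow> 0 \<le> v \<bullet> (X *v v)"
  by (simp_all add: psd_cone_def)

lemma psd_cone_closed_ops:
  "X \<in> psd_cone \<Longrightarrow> Y \<in> psd_cone \<Longrightarrow> X + Y \<in> psd_cone"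
  "X \<in> psd_cone \<Longrightarrow> 0 \<le> c \<Longrightarrow> c *\<^sub>R X \<in> psd_cone"
  "0 \<in> psd_cone" "mat 1 \<in> psd_cone" "outer v v \<in> psd_cone"
  by (auto simp: psd_cone_def sym_mats_closed mult_vec_simps inner_add_right outer_mult_vec
      inner_commute)

lemma closed_psd_cone: "closed (psd_cone :: (real ^ 'n ^ 'n) set)"
proof -
  have eq: "psd_cone = {X :: real ^ 'n ^ 'n. transpose X = X} \<inter> (\<Inter>v. {X. 0 \<le> outer v v \<bullet> X})"
    by (auto simp: psd_cone_def sym_mats_def inner_outer)
  have "closed {X :: real ^ 'n ^ 'n. transpose X = X}"
    unfolding transpose_def by (intro closed_Collect_eq continuous_intros)
  moreover have "closed {X. 0 \<le> outer v v \<bullet> X}" for v :: "real ^ 'n"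
    by (intro closed_Collect_le continuous_intros)
  ultimately show ?thesis
    unfolding eq by (intro closed_Int closed_INT ballI)
qed

lemma trace_eq_inner: "X \<in> sym_mats \<Longrightarrow> trace X = X \<bullet> mat 1"
  by (simp add: inner_eq_trace)

lemma psd_cauchy_schwarz:
  assumes "X \<in> psd_cone"
  shows "(v \<bullet> (X *v w))\<^sup>2 \<le> (v \<bullet> (X *v v)) * (w \<bullet> (X *v w))"
proof -
  define a where "a = v \<bullet> (X *v v)"
  define b where "b = v \<bullet> (X *v w)"
  define c where "c = w \<bullet> (X *v w)"
  have q: "0 \<le> a + 2 * t * b + t\<^sup>2 * c" for t
  proof -
    have "0 \<le> (v + t *\<^sub>R w) \<bullet> (X *v (v + t *\<^sub>R w))"
      by (rule psd_coneD[OF assms])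
    moreover have "w \<bullet> (X *v v) = b"
      unfolding b_def by (rule sym_mats_dot) (rule psd_coneD[OF assms])
    ultimately show ?thesis
      by (simp add: a_def b_def c_def matrix_vector_right_distrib mult_vec_simps inner_add_left
          inner_add_right power2_eq_square algebra_simps)
  qed
  have "a \<ge> 0" "c \<ge> 0"
    unfolding a_def c_def by (simp_all add: psd_coneD[OF assms])
  have "b\<^sup>2 \<le> a * c"
  proof (cases "c = 0")
    case True
    have "b = 0"
    proof (rule ccontr)
      assume "b \<noteq> 0"
      with q[of "- (a + 1) / (2 * b)"] True \<open>a \<ge> 0\<close> show False by (simp add: field_simps)
    qed
    then show ?thesis using True by simp
  next
    case False
    then have "c > 0" using \<open>c \<ge> 0\<close> by simp
    with q[of "- b / c"] show ?thesis
      by (simp add: field_simps power2_eq_square)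
  qed
  then show ?thesis by (simp add: a_def b_def c_def)
qed

lemma psd_diag_nonneg: "X \<in> psd_cone \<Longrightarrow> 0 \<le> X $ i $ i"
  using psd_coneD(2)[of X "axis i 1"] by (simp add: inner_axis' matrix_vector_mult_basis column_def)

text \<open>
  Sum the Cauchy--Schwarz inequality of the semidefinite form of \<open>X\<close> over the pairs of \<open>v\<close> with
  each coordinate vector. In particular \<open>X\<close> annihilates every vector at which its form vanishes.
\<close>
lemma psd_norm_mult_vec_le:
  assumes "X \<in> psd_cone"
  shows "(norm (X *v v))\<^sup>2 \<le> trace X * (v \<bullet> (X *v v))"
proof -
  have "((X *v v) $ i)\<^sup>2 \<le> X $ i $ i * (v \<bullet> (X *v v))" for i
    using psd_cauchy_schwarz[OF assms, of "axis i 1" v]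
    by (simp add: inner_axis' matrix_vector_mult_basis column_def)
  then have "(\<Sum>i\<in>UNIV. ((X *v v) $ i)\<^sup>2) \<le> (\<Sum>i\<in>UNIV. X $ i $ i * (v \<bullet> (X *v v)))"
    by (rule sum_mono)
  then show ?thesis
    by (simp add: power2_norm_eq_inner inner_vec_def[of "X *v v" "X *v v"] trace_def
        sum_distrib_right) (simp add: power2_eq_square)
qed

lemma psd_mult_vec_eq_0:
  assumes "X \<in> psd_cone" "v \<bullet> (X *v v) = 0"
  shows "X *v v = 0"
  using psd_norm_mult_vec_le[OF assms(1), of v] assms(2) by simp

text \<open>
  Self-duality of the cone. Removing the rank-one matrix of a nonzero pivot keeps \<open>Z\<close> semidefinite
  and lowers its number of nonzero diagonal entries, while the removed matrix has a nonnegative inner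
  product with \<open>X\<close>; so no spectral decomposition is involved.
\<close>
lemma psd_inner_nonneg:
  assumes X: "X \<in> psd_cone" and Z: "Z \<in> psd_cone"
  shows "0 \<le> X \<bullet> Z"
  using Z
proof (induction "card {i. Z $ i $ i \<noteq> 0}" arbitrary: Z rule: less_induct)
  case less
  show ?case
  proof (cases "\<exists>i. Z $ i $ i \<noteq> 0")
    case False
    then have "Z *v v = 0" for v
      using psd_norm_mult_vec_le[OF less.prems, of v] by (simp add: trace_def)
    then have "Z = 0"
      by (simp add: matrix_eq)
    then show ?thesis by simp
  next
    case True
    then obtain i where i: "Z $ i $ i \<noteq> 0" by blast
    then have pos: "0 < Z $ i $ i"
      using psd_diag_nonneg[OF less.prems, of i] by simp
    define u where "u = Z *v axis i 1"
    have Zs: "Z \<in> sym_mats" by (rule psd_coneD[OF less.prems])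
    have uj: "u $ j = Z $ j $ i" for j
      by (simp add: u_def matrix_vector_mult_basis column_def)
    \<comment> \<open>One step of the Cholesky factorisation clears the pivot \<open>i\<close>.\<close>
    define Y where "Y = Z - (1 / Z $ i $ i) *\<^sub>R outer u u"
    have Y: "Y \<in> psd_cone"
      unfolding psd_cone_def
    proof (intro CollectI conjI allI)
      show "Y \<in> sym_mats"
        unfolding Y_def by (intro sym_mats_closed Zs)
      fix v
      have "(u \<bullet> v)\<^sup>2 \<le> Z $ i $ i * (v \<bullet> (Z *v v))"
        using psd_cauchy_schwarz[OF less.prems, of "axis i 1" v] sym_mats_dot[OF Zs, of "axis i 1" v]
        by (simp add: u_def inner_axis' inner_commute matrix_vector_mult_basis column_def)
      then show "0 \<le> v \<bullet> (Y *v v)"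
        using pos
        by (simp add: Y_def mult_vec_simps outer_mult_vec inner_diff_right inner_commute
            field_simps power2_eq_square)
    qed
    have Yj: "Y $ j $ j = Z $ j $ j - (Z $ j $ i)\<^sup>2 / Z $ i $ i" for j
      by (simp add: Y_def outer_def uj power2_eq_square)
    have "{j. Y $ j $ j \<noteq> 0} \<subset> {j. Z $ j $ j \<noteq> 0}"
    proof -
      have "Y $ j $ j = 0" if "Z $ j $ j = 0" for j
        using that Yj[of j] psd_diag_nonneg[OF Y, of j] pos
        by (smt (verit) divide_nonneg_pos zero_le_power2)
      moreover have "Y $ i $ i = 0"
        using Yj[of i] by (simp add: power2_eq_square)
      ultimately show ?thesis using i by blast
    qed
    then have "card {j. Y $ j $ j \<noteq> 0} < card {j. Z $ j $ j \<noteq> 0}"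
      by (intro psubset_card_mono) auto
    from less.hyps[OF this Y] have "0 \<le> X \<bullet> Y" .
    moreover have "X \<bullet> Z = X \<bullet> Y + (1 / Z $ i $ i) * (u \<bullet> (X *v u))"
      by (simp add: Y_def inner_diff_right inner_commute[of X "outer u u"] inner_outer)
    moreover have "0 \<le> u \<bullet> (X *v u)" by (rule psd_coneD[OF X])
    ultimately show ?thesis using pos by simp
  qed
qed

section \<open>The least shift into the semidefinite cone\<close>

text \<open>
  For symmetric \<open>Z\<close> this is the least \<open>l \<ge> 0\<close> with \<open>Z + l *\<^sub>R mat 1\<close> positive semidefinite; see
  \<open>psd_defect_shift\<close> and \<open>psd_defect_le\<close>, through which all later reasoning about \<open>lambda_max\<close> passes.
\<close>
definition psd_defect :: "real ^ 'n ^ 'n \<Rightarrow> real" where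
  "psd_defect Z = max 0 (lambda_max (- Z))"

text \<open>
  Eigenvectors of distinct eigenvalues are orthogonal, hence linearly independent. Finiteness is what
  gives the \<open>Max\<close> in \<open>lambda_max\<close> its meaning.
\<close>
lemma finite_eigenvalues:
  fixes X :: "real ^ 'n ^ 'n"
  assumes "X \<in> sym_mats"
  shows "finite {l. \<exists>v. v \<noteq> 0 \<and> X *v v = l *\<^sub>R v}" (is "finite ?E")
proof -
  define f where "f l = (SOME v. v \<noteq> 0 \<and> X *v v = l *\<^sub>R v)" for l
  have f: "f l \<noteq> 0" "X *v f l = l *\<^sub>R f l" if "l \<in> ?E" for l
    using someI_ex[of "\<lambda>v. v \<noteq> 0 \<and> X *v v = l *\<^sub>R v"] that by (auto simp: f_def)
  have orth: "f k \<bullet> f l = 0" if "k \<in> ?E" "l \<in> ?E" "k \<noteq> l" for k l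
  proof -
    have "l * (f k \<bullet> f l) = k * (f k \<bullet> f l)"
      using sym_mats_dot[OF assms, of "f k" "f l"] f(2)[OF that(1)] f(2)[OF that(2)]
      by (simp add: inner_commute)
    then show ?thesis using that(3) by simp
  qed
  have "inj_on f ?E"
  proof (rule inj_onI, rule ccontr)
    fix k l assume "k \<in> ?E" "l \<in> ?E" "f k = f l" "k \<noteq> l"
    then have "f l \<bullet> f l = 0" using orth[of k l] by simp
    then show False using f(1)[OF \<open>l \<in> ?E\<close>] by simp
  qed
  moreover have "independent (f ` ?E)"
    by (rule pairwise_orthogonal_independent)
      (use f(1) orth in \<open>force simp: pairwise_def orthogonal_def\<close>)+
  then have "finite (f ` ?E)" by (rule independent_imp_finite)
  ultimately show ?thesis using finite_imageD by blast
qed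

text \<open>
  A minimiser \<open>v\<close> of the quadratic form on the unit sphere makes \<open>X - l *\<^sub>R mat 1\<close> semidefinite with
  vanishing form at \<open>v\<close>, and a semidefinite matrix annihilates such a vector.
\<close>
lemma rayleigh_min_eigenvalue:
  fixes X :: "real ^ 'n ^ 'n"
  assumes X: "X \<in> sym_mats"
  obtains v l where "v \<noteq> 0" "X *v v = l *\<^sub>R v" "X - l *\<^sub>R mat 1 \<in> psd_cone"
proof -
  have "compact (sphere (0 :: real ^ 'n) 1)" by simp
  moreover have "sphere (0 :: real ^ 'n) 1 \<noteq> {}" by simp
  moreover have "continuous_on (sphere 0 1) (\<lambda>v. v \<bullet> (X *v v))"
    by (intro continuous_intros linear_continuous_on matrix_vector_mul_bounded_linear)
  ultimately obtain v where v: "norm v = 1"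
    and min: "\<And>w. norm w = 1 \<Longrightarrow> v \<bullet> (X *v v) \<le> w \<bullet> (X *v w)"
    using continuous_attains_inf[of "sphere 0 1" "\<lambda>v. v \<bullet> (X *v v)"] by auto
  define l where "l = v \<bullet> (X *v v)"
  have psd: "X - l *\<^sub>R mat 1 \<in> psd_cone"
    unfolding psd_cone_def
  proof (intro CollectI conjI allI)
    show "X - l *\<^sub>R mat 1 \<in> sym_mats" by (intro sym_mats_closed X)
    fix w :: "real ^ 'n"
    have "l * (norm w)\<^sup>2 \<le> w \<bullet> (X *v w)"
    proof (cases "w = 0")
      case False
      then have "l \<le> (1 / norm w) * (1 / norm w) * (w \<bullet> (X *v w))"
        using min[of "(1 / norm w) *\<^sub>R w"] by (simp add: l_def mult_vec_simps)
      then show ?thesis using False by (simp add: field_simps power2_eq_square)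
    qed simp
    then show "0 \<le> w \<bullet> ((X - l *\<^sub>R mat 1) *v w)"
      by (simp add: mult_vec_simps inner_diff_right power2_norm_eq_inner)
  qed
  have "(X - l *\<^sub>R mat 1) *v v = 0"
    using v by (intro psd_mult_vec_eq_0[OF psd])
      (simp add: mult_vec_simps inner_diff_right l_def power2_norm_eq_inner[symmetric])
  then have "X *v v = l *\<^sub>R v" by (simp add: mult_vec_simps)
  moreover have "v \<noteq> 0" using v by auto
  ultimately show ?thesis using psd that by blast
qed

lemma psd_defect_nonneg: "0 \<le> psd_defect Z"
  by (simp add: psd_defect_def)

lemma psd_defect_shift:
  assumes Z: "Z \<in> sym_mats"
  shows "Z + psd_defect Z *\<^sub>R mat 1 \<in> psd_cone"
proof -
  obtain v l where v: "v \<noteq> 0" "Z *v v = l *\<^sub>R v" "Z - l *\<^sub>R mat 1 \<in> psd_cone"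
    using rayleigh_min_eigenvalue[OF Z] .
  have "- l \<le> lambda_max (- Z)"
    unfolding lambda_max_def
    by (rule Max_ge[OF finite_eigenvalues[OF sym_mats_closed(3)[OF Z]]])
      (use v in \<open>auto simp: mult_vec_simps intro!: exI[of _ v]\<close>)
  then have "0 \<le> l + psd_defect Z" by (simp add: psd_defect_def)
  then have "(Z - l *\<^sub>R mat 1) + (l + psd_defect Z) *\<^sub>R mat 1 \<in> psd_cone"
    by (intro psd_cone_closed_ops v)
  then show ?thesis by (simp add: scaleR_add_left)
qed

lemma psd_defect_le:
  assumes Z: "Z \<in> sym_mats" and "0 \<le> m" and psd: "Z + m *\<^sub>R mat 1 \<in> psd_cone"
  shows "psd_defect Z \<le> m"
proof -
  let ?E = "{l. \<exists>v. v \<noteq> 0 \<and> (- Z) *v v = l *\<^sub>R v}"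
  have fin: "finite ?E" by (rule finite_eigenvalues[OF sym_mats_closed(3)[OF Z]])
  obtain v l where v: "v \<noteq> 0" "Z *v v = l *\<^sub>R v"
    using rayleigh_min_eigenvalue[OF Z] .
  then have "- l \<in> ?E" by (auto simp: mult_vec_simps intro!: exI[of _ v])
  then have ne: "?E \<noteq> {}" by blast
  have "k \<le> m" if "k \<in> ?E" for k
  proof -
    from that obtain w where w: "w \<noteq> 0" "(- Z) *v w = k *\<^sub>R w" by blast
    have "w \<bullet> (Z *v w) = - k * (w \<bullet> w)"
      using arg_cong[OF w(2), of "inner w"] by (simp add: mult_vec_simps)
    then have "0 \<le> (m - k) * (w \<bullet> w)"
      using psd_coneD(2)[OF psd, of w] by (simp add: mult_vec_simps inner_add_right algebra_simps)
    moreover have "0 < w \<bullet> w" using w by simp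
    ultimately show ?thesis by (simp add: zero_le_mult_iff)
  qed
  then have "lambda_max (- Z) \<le> m"
    unfolding lambda_max_def using Max_in[OF fin ne] by blast
  then show ?thesis using \<open>0 \<le> m\<close> by (simp add: psd_defect_def)
qed

lemma psd_defect_le_norm:
  assumes Z: "Z \<in> sym_mats"
  shows "psd_defect Z \<le> norm Z"
proof (rule psd_defect_le[OF Z])
  show "Z + norm Z *\<^sub>R mat 1 \<in> psd_cone"
    unfolding psd_cone_def
  proof (intro CollectI conjI allI)
    show "Z + norm Z *\<^sub>R mat 1 \<in> sym_mats" by (intro sym_mats_closed Z)
    fix v
    show "0 \<le> v \<bullet> ((Z + norm Z *\<^sub>R mat 1) *v v)"
      using quad_form_abs_le[of v Z]
      by (simp add: mult_vec_simps inner_add_right power2_norm_eq_inner)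
  qed
qed simp

lemma psd_defect_eq_0: "Z \<in> psd_cone \<Longrightarrow> psd_defect Z = 0"
  using psd_defect_le[of Z 0] psd_defect_nonneg[of Z] by (simp add: psd_coneD)

section \<open>Frobenius norm and compression by projections\<close>

lemma norm_power2_rows: "(norm (M :: real ^ 'n ^ 'm))\<^sup>2 = (\<Sum>i\<in>UNIV. (norm (M $ i))\<^sup>2)"
  by (simp add: power2_norm_eq_inner inner_vec_def)

lemma norm_power2_columns:
  "(norm (M :: real ^ 'n ^ 'm))\<^sup>2 = (\<Sum>j\<in>UNIV. (norm (M *v axis j 1))\<^sup>2)"
proof -
  have "(norm M)\<^sup>2 = (\<Sum>i\<in>UNIV. \<Sum>j\<in>UNIV. (M $ i $ j)\<^sup>2)"
    by (simp only: power2_norm_eq_inner inner_vec_def) (simp add: power2_eq_square)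
  also have "\<dots> = (\<Sum>j\<in>UNIV. \<Sum>i\<in>UNIV. (M $ i $ j)\<^sup>2)"
    by (rule sum.swap)
  also have "\<dots> = (\<Sum>j\<in>UNIV. (norm (M *v axis j 1))\<^sup>2)"
    by (simp only: power2_norm_eq_inner inner_vec_def)
      (simp add: power2_eq_square matrix_vector_mult_basis column_def)
  finally show ?thesis .
qed

lemma norm_mult_vec_le: "norm ((M :: real ^ 'n ^ 'm) *v v) \<le> norm M * norm v"
proof (rule power2_le_imp_le)
  have "((M *v v) $ i)\<^sup>2 \<le> (norm (M $ i))\<^sup>2 * (norm v)\<^sup>2" for i
  proof -
    have "(M *v v) $ i = M $ i \<bullet> v"
      by (simp add: matrix_vector_mult_def inner_vec_def)
    then show ?thesis
      using Cauchy_Schwarz_ineq[of "M $ i" v] by (simp add: power2_norm_eq_inner)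
  qed
  then have "(\<Sum>i\<in>UNIV. ((M *v v) $ i)\<^sup>2) \<le> (\<Sum>i\<in>UNIV. (norm (M $ i))\<^sup>2 * (norm v)\<^sup>2)"
    by (rule sum_mono)
  moreover have "(norm (M *v v))\<^sup>2 = (\<Sum>i\<in>UNIV. ((M *v v) $ i)\<^sup>2)"
    by (simp only: power2_norm_eq_inner inner_vec_def) (simp add: power2_eq_square)
  ultimately show "(norm (M *v v))\<^sup>2 \<le> (norm M * norm v)\<^sup>2"
    by (simp add: power_mult_distrib norm_power2_rows sum_distrib_right)
qed simp

lemma norm_matrix_mult_le:
  "norm ((M :: real ^ 'n ^ 'm) ** (N :: real ^ 'k ^ 'n)) \<le> norm M * norm N"
proof (rule power2_le_imp_le)
  have "(norm (M *v (N *v axis j 1)))\<^sup>2 \<le> (norm M)\<^sup>2 * (norm (N *v axis j 1))\<^sup>2" for j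
    by (metis norm_ge_zero norm_mult_vec_le power_mono power_mult_distrib)
  then have "(\<Sum>j\<in>UNIV. (norm (M *v (N *v axis j 1)))\<^sup>2)
      \<le> (\<Sum>j\<in>UNIV. (norm M)\<^sup>2 * (norm (N *v axis j 1))\<^sup>2)"
    by (rule sum_mono)
  then show "(norm (M ** N))\<^sup>2 \<le> (norm M * norm N)\<^sup>2"
    by (simp add: power_mult_distrib norm_power2_columns[of "M ** N"] norm_power2_columns[of N]
        sum_distrib_left flip: matrix_vector_mul_assoc)
qed simp

lemma norm_transpose: "norm (transpose (M :: real ^ 'n ^ 'n)) = norm M"
proof -
  have "(norm (transpose M))\<^sup>2 = (norm M)\<^sup>2"
    unfolding norm_power2_rows[of "transpose M"] norm_power2_columns[of M]
    by (simp add: matrix_vector_mult_basis row_def column_def transpose_def)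
  then show ?thesis by (simp add: power2_eq_iff_nonneg)
qed

lemma proj_quad_form:
  assumes "P \<in> sym_mats" "P ** P = P"
  shows "v \<bullet> (P *v v) = (norm (P *v v))\<^sup>2"
proof -
  have "(P *v v) \<bullet> (P *v v) = v \<bullet> (P *v (P *v v))"
    using sym_mats_dot[OF assms(1), of "P *v v" v] by simp
  then show ?thesis
    by (simp add: power2_norm_eq_inner matrix_vector_mul_assoc assms(2))
qed

lemma proj_psd: "P \<in> sym_mats \<Longrightarrow> P ** P = P \<Longrightarrow> P \<in> psd_cone"
  by (simp add: psd_cone_def proj_quad_form)

lemma compl_proj:
  assumes "P \<in> sym_mats" "P ** P = P"
  shows "mat 1 - P \<in> sym_mats" "(mat 1 - P) ** (mat 1 - P) = mat 1 - P"
proof -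
  show "mat 1 - P \<in> sym_mats" by (intro sym_mats_closed assms)
  show "(mat 1 - P) ** (mat 1 - P) = mat 1 - P"
    by (simp add: matrix_eq assms(2) mult_vec_simps matrix_vector_mul_assoc[symmetric]
        matrix_vector_mult_diff_distrib)
      (simp add: matrix_vector_mul_assoc assms(2))
qed

text \<open>
  If \<open>P ** W ** P = W\<close> for a projection \<open>P\<close>, this and \<open>quad_form_abs_le\<close> bound the form of \<open>W\<close> by
  \<open>norm W\<close> times that of \<open>P\<close>.
\<close>
lemma quad_form_compression:
  assumes "P \<in> sym_mats"
  shows "v \<bullet> ((P ** W ** P) *v v) = (P *v v) \<bullet> (W *v (P *v v))"
  using sym_mats_dot[OF assms, of v "W *v (P *v v)"]
  by (simp add: inner_commute flip: matrix_vector_mul_assoc)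

lemma sym_mats_compression: "P \<in> sym_mats \<Longrightarrow> W \<in> sym_mats \<Longrightarrow> P ** W ** P \<in> sym_mats"
  by (simp add: sym_mats_iff matrix_transpose_mul matrix_mul_assoc)

lemma psd_compression:
  assumes "P \<in> sym_mats" "W \<in> psd_cone"
  shows "P ** W ** P \<in> psd_cone"
  unfolding psd_cone_def
proof (intro CollectI conjI allI)
  show "P ** W ** P \<in> sym_mats" by (intro sym_mats_compression assms psd_coneD)
  fix v
  show "0 \<le> v \<bullet> ((P ** W ** P) *v v)"
    unfolding quad_form_compression[OF assms(1)] by (rule psd_coneD[OF assms(2)])
qed

text \<open>
  On the unit sphere of the range of \<open>Z\<close> the form of \<open>Z\<close> is positive, because a vector in the range
  that \<open>Z\<close> annihilates is orthogonal to itself. Compactness gives the lower bound \<open>m\<close>.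
\<close>
lemma psd_range_projection:
  fixes Z :: "real ^ 'n ^ 'n"
  assumes Z: "Z \<in> psd_cone"
  obtains P m where "P \<in> sym_mats" "P ** P = P" "P ** Z = Z" "0 < m" "Z - m *\<^sub>R P \<in> psd_cone"
proof -
  define S where "S = range ((*v) Z)"
  have Zs: "Z \<in> sym_mats" by (rule psd_coneD[OF Z])
  have subS: "subspace S"
    unfolding S_def by (rule linear_subspace_image) (simp_all add: matrix_vector_mul_linear)
  then obtain B where BS: "B \<subseteq> S" and orth: "pairwise orthogonal B"
    and nB: "\<And>x. x \<in> B \<Longrightarrow> norm x = 1" and ind: "independent B" and sp: "span B = S"
    using orthonormal_basis_subspace by metis
  have finB: "finite B" using ind by (rule independent_imp_finite)
  define P where "P = (\<Sum>x\<in>B. outer x x)"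
  have Pv: "P *v v = (\<Sum>x\<in>B. (x \<bullet> v) *\<^sub>R x)" for v
    unfolding P_def using finB
    by (induction B rule: finite_induct) (simp_all add: mult_vec_simps outer_mult_vec)
  have Ps: "P \<in> sym_mats"
    unfolding P_def using finB
    by (induction B rule: finite_induct) (simp_all add: sym_mats_closed)
  have PS: "P *v v \<in> S" for v
    unfolding Pv sp[symmetric] by (intro span_sum span_scale span_base)
  have PB: "P *v x = x" if "x \<in> B" for x
  proof -
    have "(\<Sum>y\<in>B. (y \<bullet> x) *\<^sub>R y) = (\<Sum>y\<in>B. if y = x then x else 0)"
    proof (rule sum.cong)
      fix y assume "y \<in> B"
      then show "(y \<bullet> x) *\<^sub>R y = (if y = x then x else 0)"
        using orth nB[OF that] that
        by (auto simp: pairwise_def orthogonal_def power2_norm_eq_inner[symmetric])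
    qed simp
    then show ?thesis using finB that by (simp add: Pv)
  qed
  have Pid: "P *v v = v" if "v \<in> S" for v
  proof -
    have "P *v v = id v"
      by (rule linear_eq_on_span[of "(*v) P" id B])
        (use PB that sp in \<open>simp_all add: matrix_vector_mul_linear linear_id\<close>)
    then show ?thesis by simp
  qed
  have PP: "P ** P = P"
    by (simp add: matrix_eq Pid PS flip: matrix_vector_mul_assoc)
  have "Z *v v \<in> S" for v by (simp add: S_def)
  then have PZ: "P ** Z = Z"
    by (simp add: matrix_eq Pid flip: matrix_vector_mul_assoc)
  obtain m where m: "0 < m" "\<And>v. v \<in> S \<Longrightarrow> norm v = 1 \<Longrightarrow> m \<le> v \<bullet> (Z *v v)"
  proof (cases "S \<inter> sphere 0 1 = {}")
    case True
    show ?thesis by (rule that[of 1]) (use True in auto)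
  next
    case False
    have "compact (S \<inter> sphere 0 1)"
      using subS by (intro closed_Int_compact closed_subspace) simp_all
    moreover have "continuous_on (S \<inter> sphere 0 1) (\<lambda>v. v \<bullet> (Z *v v))"
      by (intro continuous_intros linear_continuous_on matrix_vector_mul_bounded_linear)
    ultimately have "\<exists>u\<in>S \<inter> sphere 0 1. \<forall>w\<in>S \<inter> sphere 0 1. u \<bullet> (Z *v u) \<le> w \<bullet> (Z *v w)"
      using False by (intro continuous_attains_inf)
    then obtain u where u: "u \<in> S" "norm u = 1"
      and min: "\<And>w. w \<in> S \<Longrightarrow> norm w = 1 \<Longrightarrow> u \<bullet> (Z *v u) \<le> w \<bullet> (Z *v w)"
      by auto
    have "u \<bullet> (Z *v u) \<noteq> 0"
    proof
      assume "u \<bullet> (Z *v u) = 0"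
      then have "Z *v u = 0" by (rule psd_mult_vec_eq_0[OF Z])
      moreover obtain w where "u = Z *v w" using u(1) by (auto simp: S_def)
      ultimately have "u \<bullet> u = 0" using sym_mats_dot[OF Zs, of u w] by simp
      then show False using u(2) by simp
    qed
    then have "0 < u \<bullet> (Z *v u)" using psd_coneD(2)[OF Z, of u] by simp
    then show ?thesis using that min by blast
  qed
  have "Z ** P = transpose (P ** Z)"
    using Ps Zs by (simp add: sym_mats_iff matrix_transpose_mul)
  then have PZP: "P ** Z ** P = Z"
    using Zs by (simp add: PZ sym_mats_iff)
  have "Z - m *\<^sub>R P \<in> psd_cone"
    unfolding psd_cone_def
  proof (intro CollectI conjI allI)
    show "Z - m *\<^sub>R P \<in> sym_mats" by (intro sym_mats_closed Zs Ps)
    fix v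
    define u where "u = P *v v"
    have "m * (norm u)\<^sup>2 \<le> u \<bullet> (Z *v u)"
    proof (cases "u = 0")
      case False
      have "(1 / norm u) *\<^sub>R u \<in> S"
        unfolding u_def using PS subS by (intro subspace_scale)
      then have "m \<le> (1 / norm u) * (1 / norm u) * (u \<bullet> (Z *v u))"
        using m(2)[of "(1 / norm u) *\<^sub>R u"] False by (simp add: mult_vec_simps)
      then show ?thesis using False by (simp add: field_simps power2_eq_square)
    qed simp
    then show "0 \<le> v \<bullet> ((Z - m *\<^sub>R P) *v v)"
      unfolding u_def
      by (simp add: mult_vec_simps inner_diff_right proj_quad_form[OF Ps PP]
          quad_form_compression[OF Ps, of v Z, unfolded PZP])
  qed
  then show ?thesis using that Ps PP PZ m(1) by blast
qed

section \<open>Strict complementarity as a pair of spectral gaps\<close>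

lemma polar_cone_psd: "polar_cone psd_cone = {V. - V \<in> psd_cone}"
proof (intro set_eqI iffI)
  fix V :: "real ^ 'n ^ 'n"
  assume V: "V \<in> polar_cone psd_cone"
  then have "outer v v \<bullet> V \<le> 0" for v
    using psd_cone_closed_ops(5)[of v] by (auto simp: polar_cone_def inner_commute)
  then show "V \<in> {V. - V \<in> psd_cone}"
    using V by (auto simp: psd_cone_def polar_cone_def inner_outer mult_vec_simps sym_mats_closed)
next
  fix V :: "real ^ 'n ^ 'n"
  assume "V \<in> {V. - V \<in> psd_cone}"
  then have V: "- V \<in> psd_cone" by simp
  then have "V \<in> sym_mats" using sym_mats_closed(3)[OF psd_coneD(1)[OF V]] by simp
  then show "V \<in> polar_cone psd_cone"
    using psd_inner_nonneg[OF V] by (simp add: polar_cone_def)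
qed

text \<open>
  The test points \<open>0\<close> and \<open>- 2 *\<^sub>R Z\<close> of the polar cone force \<open>V \<bullet> Z = 0\<close>, and the negated rank-one
  matrices then force \<open>V\<close> to be semidefinite.
\<close>
lemma normal_cone_polar_psd:
  assumes Z: "Z \<in> psd_cone"
  shows "normal_cone (polar_cone psd_cone) (- Z) = {V \<in> psd_cone. V \<bullet> Z = 0}"
proof (intro set_eqI iffI)
  fix V
  assume V: "V \<in> normal_cone (polar_cone psd_cone) (- Z)"
  then have le: "V \<bullet> (Y + Z) \<le> 0" if "- Y \<in> psd_cone" for Y
    using that by (simp add: normal_cone_def polar_cone_psd)
  have "V \<bullet> Z \<le> 0" using le[of 0] by (simp add: psd_cone_closed_ops)
  moreover have "0 \<le> V \<bullet> Z"
    using le[of "- (2 *\<^sub>R Z)"] Z by (simp add: psd_cone_closed_ops inner_add_right inner_diff_right)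
  ultimately have VZ: "V \<bullet> Z = 0" by simp
  have "0 \<le> v \<bullet> (V *v v)" for v
    using le[of "- outer v v"] VZ psd_cone_closed_ops(5)[of v]
    by (simp add: inner_diff_right inner_commute[of V "outer v v"] inner_outer)
  then show "V \<in> {V \<in> psd_cone. V \<bullet> Z = 0}"
    using V VZ by (simp add: psd_cone_def normal_cone_def)
next
  fix V
  assume "V \<in> {V \<in> psd_cone. V \<bullet> Z = 0}"
  then have V: "V \<in> psd_cone" "V \<bullet> Z = 0" by simp_all
  have "V \<bullet> (Y + Z) \<le> 0" if "- Y \<in> psd_cone" for Y
    using psd_inner_nonneg[OF V(1) that] V(2) by (simp add: inner_add_right)
  then show "V \<in> normal_cone (polar_cone psd_cone) (- Z)"
    using V Z psd_coneD(1)[OF V(1)] by (simp add: normal_cone_def polar_cone_psd)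
qed

text \<open>
  With \<open>P\<close> the projection onto the range of \<open>Z\<close>, the two existential conditions are lower bounds on
  the nonzero eigenvalues of \<open>Z\<close> and on the eigenvalues of \<open>X\<close> on the kernel of \<open>Z\<close>. In this form
  strict complementarity can be used through inner products alone.
\<close>
definition complementary_projection ::
    "real ^ 'n ^ 'n \<Rightarrow> real ^ 'n ^ 'n \<Rightarrow> real ^ 'n ^ 'n \<Rightarrow> bool" where
  "complementary_projection X Z P \<longleftrightarrow>
     P \<in> sym_mats \<and> P ** P = P \<and> X \<in> psd_cone \<and> X \<bullet> P = 0 \<and> P ** Z ** P = Z \<and>
     (\<exists>m>0. Z - m *\<^sub>R P \<in> psd_cone) \<and> (\<exists>n>0. X - n *\<^sub>R (mat 1 - P) \<in> psd_cone)"

text \<open>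
  The projection \<open>mat 1 - P\<close> onto the kernel of \<open>Z\<close> lies in the normal cone. A point of the relative
  interior can be pushed a little away from it without leaving the cone, which is the lower bound
  on \<open>X\<close>.
\<close>
lemma strict_complementarity_projection:
  assumes Z: "Z \<in> psd_cone"
    and X: "X \<in> rel_interior (normal_cone (polar_cone psd_cone) (- Z))"
  obtains P where "complementary_projection X Z P"
proof -
  let ?N = "{V \<in> psd_cone. V \<bullet> Z = 0}"
  have XN: "X \<in> rel_interior ?N" using X by (simp add: normal_cone_polar_psd[OF Z])
  then have X0: "X \<in> psd_cone" "X \<bullet> Z = 0" using rel_interior_subset by blast+
  obtain P m where P: "P \<in> sym_mats" "P ** P = P" "P ** Z = Z"
    and m: "0 < m" "Z - m *\<^sub>R P \<in> psd_cone"
    using psd_range_projection[OF Z] .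
  let ?Q = "mat 1 - P"
  have "?Q ** Z = 0"
    using P(3) by (simp add: matrix_eq mult_vec_simps flip: matrix_vector_mul_assoc)
  then have QN: "?Q \<in> ?N"
    using proj_psd[OF compl_proj[OF P(1,2)]] inner_eq_trace[OF compl_proj(1)[OF P(1,2)], of Z]
    by (simp add: trace_def)
  have "convex ?N"
    by (auto simp: convex_def psd_cone_closed_ops inner_add_left)
  then obtain e where e: "1 < e" "(1 - e) *\<^sub>R ?Q + e *\<^sub>R X \<in> ?N"
    using XN QN convex_rel_interior_iff[of ?N X] by blast
  have "(1 / e) *\<^sub>R ((1 - e) *\<^sub>R ?Q + e *\<^sub>R X) \<in> psd_cone"
    using e by (intro psd_cone_closed_ops(2)) auto
  moreover have "(1 / e) *\<^sub>R ((1 - e) *\<^sub>R ?Q + e *\<^sub>R X) = X - ((e - 1) / e) *\<^sub>R ?Q"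
    using e(1) by (simp add: scaleR_add_right diff_divide_distrib algebra_simps)
  ultimately have n: "X - ((e - 1) / e) *\<^sub>R ?Q \<in> psd_cone" by simp
  have "0 \<le> X \<bullet> (Z - m *\<^sub>R P)" by (rule psd_inner_nonneg[OF X0(1) m(2)])
  then have "X \<bullet> P \<le> 0"
    using m(1) X0(2) by (simp add: inner_diff_right mult_le_0_iff)
  moreover have "0 \<le> X \<bullet> P" by (intro psd_inner_nonneg X0 proj_psd P)
  ultimately have "X \<bullet> P = 0" by simp
  moreover have "Z ** P = transpose (P ** Z)"
    using P(1) psd_coneD(1)[OF Z] by (simp add: sym_mats_iff matrix_transpose_mul)
  then have "P ** Z ** P = Z"
    using psd_coneD(1)[OF Z] by (simp add: P(3) sym_mats_iff)
  moreover have "0 < (e - 1) / e" using e(1) by simp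
  ultimately have "complementary_projection X Z P"
    unfolding complementary_projection_def using P X0 m n by blast
  then show ?thesis by (rule that)
qed

text \<open>
  Such a \<open>W\<close> is dominated by \<open>norm W *\<^sub>R P\<close>, and \<open>X \<bullet> P = 0\<close>.
\<close>
lemma compressed_psd_inner_eq_0:
  assumes c: "complementary_projection X Z P" and W: "W \<in> psd_cone" "P ** W ** P = W"
  shows "X \<bullet> W = 0"
proof -
  have P: "P \<in> sym_mats" "P ** P = P" "X \<in> psd_cone" "X \<bullet> P = 0"
    using c by (simp_all add: complementary_projection_def)
  have "norm W *\<^sub>R P - W \<in> psd_cone"
    unfolding psd_cone_def
  proof (intro CollectI conjI allI)
    show "norm W *\<^sub>R P - W \<in> sym_mats" by (intro sym_mats_closed P psd_coneD[OF W(1)])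
    fix v
    show "0 \<le> v \<bullet> ((norm W *\<^sub>R P - W) *v v)"
      using quad_form_abs_le[of "P *v v" W]
      by (simp add: mult_vec_simps inner_diff_right proj_quad_form[OF P(1,2)]
          quad_form_compression[OF P(1), of v W, unfolded W(2)])
  qed
  from psd_inner_nonneg[OF P(3) this] psd_inner_nonneg[OF P(3) W(1)] P(4)
  show ?thesis by (simp add: inner_diff_right)
qed

text \<open>
  With \<open>Q = mat 1 - P\<close> the difference is \<open>Q ** W + P ** W ** Q\<close>, of norm at most a constant times
  \<open>norm (W ** Q)\<close>. The bound \<open>psd_norm_mult_vec_le\<close>, applied to the columns of \<open>Q\<close>, gives
  \<open>trace W * (Q \<bullet> W)\<close> for the square of this norm, and \<open>Q \<bullet> W\<close> is at most a multiple of \<open>X \<bullet> W\<close>.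
\<close>
lemma compression_error:
  assumes c: "complementary_projection X Z P"
  obtains K where "0 < K"
    "\<And>W. W \<in> psd_cone \<Longrightarrow> (norm (W - P ** W ** P))\<^sup>2 \<le> K * norm W * (X \<bullet> W)"
proof -
  have P: "P \<in> sym_mats" "P ** P = P" using c by (simp_all add: complementary_projection_def)
  obtain n where n: "0 < n" "X - n *\<^sub>R (mat 1 - P) \<in> psd_cone"
    using c by (auto simp: complementary_projection_def)
  define Q where "Q = mat 1 - P"
  have Q: "Q \<in> sym_mats" "Q ** Q = Q" unfolding Q_def by (rule compl_proj[OF P])+
  have tQ: "transpose Q = Q" using Q(1) by (simp add: sym_mats_iff)
  define N where "N = norm (mat 1 :: real ^ 'a ^ 'a)"
  \<comment> \<open>The summand \<open>1\<close> only makes the constant positive.\<close>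
  have "(norm (W - P ** W ** P))\<^sup>2 \<le> ((1 + norm P)\<^sup>2 * N / n + 1) * norm W * (X \<bullet> W)"
    if W: "W \<in> psd_cone" for W
  proof -
    have Ws: "W \<in> sym_mats" by (rule psd_coneD[OF W])
    have Q_W: "Q \<bullet> W = (\<Sum>j\<in>UNIV. (Q *v axis j 1) \<bullet> (W *v (Q *v axis j 1)))"
    proof -
      have "(Q *v axis j 1) \<bullet> (W *v (Q *v axis j 1)) = (Q ** W ** Q) $ j $ j" for j
        using quad_form_compression[OF Q(1), of "axis j 1" W]
        by (simp add: inner_axis' column_def del: matrix_vector_mul_assoc
            add: matrix_vector_mult_basis[of "Q ** W ** Q"])
      then have "(\<Sum>j\<in>UNIV. (Q *v axis j 1) \<bullet> (W *v (Q *v axis j 1))) = trace (Q ** W ** Q)"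
        by (simp add: trace_def)
      also have "\<dots> = trace (Q ** W)"
        by (subst trace_mul_sym) (simp add: matrix_mul_assoc Q)
      finally show ?thesis by (simp add: inner_eq_trace[OF Q(1)])
    qed
    have "(norm (W ** Q))\<^sup>2 = (\<Sum>j\<in>UNIV. (norm (W *v (Q *v axis j 1)))\<^sup>2)"
      by (simp add: norm_power2_columns flip: matrix_vector_mul_assoc)
    also have "\<dots> \<le> (\<Sum>j\<in>UNIV. trace W * ((Q *v axis j 1) \<bullet> (W *v (Q *v axis j 1))))"
      by (intro sum_mono psd_norm_mult_vec_le[OF W])
    also have "\<dots> = trace W * (Q \<bullet> W)" by (simp add: Q_W sum_distrib_left)
    finally have 1: "(norm (W ** Q))\<^sup>2 \<le> trace W * (Q \<bullet> W)" .
    have trW: "trace W \<le> N * norm W"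
      using norm_cauchy_schwarz[of W "mat 1"]
      by (simp add: trace_eq_inner[OF Ws] N_def mult.commute)
    have QW: "n * (Q \<bullet> W) \<le> X \<bullet> W"
      using psd_inner_nonneg[OF n(2) W] by (simp add: Q_def inner_diff_left)
    have QW0: "0 \<le> Q \<bullet> W" by (intro psd_inner_nonneg W proj_psd Q)
    have "trace W * (Q \<bullet> W) \<le> (N * norm W) * ((X \<bullet> W) / n)"
      using QW n(1) by (intro mult_mono trW QW0) (simp_all add: N_def field_simps)
    with 1 have 2: "(norm (W ** Q))\<^sup>2 \<le> N / n * norm W * (X \<bullet> W)" by (simp add: mult_ac)
    have "W - P ** W ** P = Q ** W + P ** (W ** Q)"
      unfolding Q_def
      by (simp add: matrix_eq mult_vec_simps matrix_vector_mult_diff_distrib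
          matrix_vector_right_distrib flip: matrix_vector_mul_assoc)
    then have "norm (W - P ** W ** P) \<le> norm (Q ** W) + norm P * norm (W ** Q)"
      using norm_triangle_ineq[of "Q ** W" "P ** (W ** Q)"] norm_matrix_mult_le[of P "W ** Q"]
      by simp
    moreover have "norm (Q ** W) = norm (W ** Q)"
      using norm_transpose[of "W ** Q"] Ws by (simp add: matrix_transpose_mul tQ sym_mats_iff)
    ultimately have "norm (W - P ** W ** P) \<le> (1 + norm P) * norm (W ** Q)"
      by (simp add: algebra_simps)
    then have "(norm (W - P ** W ** P))\<^sup>2 \<le> (1 + norm P)\<^sup>2 * (norm (W ** Q))\<^sup>2"
      by (metis norm_ge_zero power_mono power_mult_distrib)
    also have "\<dots> \<le> (1 + norm P)\<^sup>2 * (N / n * norm W * (X \<bullet> W))"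
      using 2 by (intro mult_left_mono) simp_all
    also have "\<dots> \<le> ((1 + norm P)\<^sup>2 * N / n + 1) * norm W * (X \<bullet> W)"
    proof -
      have "0 \<le> X \<bullet> W" using QW QW0 n(1) by (smt (verit) mult_nonneg_nonneg)
      then show ?thesis by (simp add: algebra_simps)
    qed
    finally show ?thesis .
  qed
  moreover have "0 < (1 + norm P)\<^sup>2 * N / n + 1"
    using n(1) by (intro add_nonneg_pos) (simp_all add: N_def)
  ultimately show ?thesis using that by blast
qed

section \<open>A linear error bound on the face of the optimal slacks\<close>

lemma linear_adjA: "linear (adjA A)"
  by (rule linearI) (simp_all add: adjA_def algebra_simps sum.distrib scaleR_sum_right)

lemma inner_adjA: "X \<bullet> adjA A y = opA A X \<bullet> y"
  by (simp add: adjA_def opA_def inner_sum_right inner_vec_def[of _ y] inner_commute[of X] mult.commute)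

text \<open>
  A Slater argument inside the face of all semidefinite \<open>U\<close> with \<open>P ** U ** P = U\<close>. The residual at
  \<open>(u, U)\<close> is the image of \<open>(y, Z) - (u, U)\<close> under the linear map \<open>T\<close>, so a linear right inverse of \<open>T\<close>
  on the span of the face corrects the equation by a step \<open>(w, W)\<close> of size proportional to the
  residual. The correction may destroy semidefiniteness by at most \<open>norm W\<close> times \<open>P\<close>; a convex
  combination with \<open>(y, Z)\<close>, where \<open>Z\<close> dominates \<open>m *\<^sub>R P\<close>, repairs it.
\<close>
lemma face_error_bound:
  fixes A :: "'m::finite \<Rightarrow> real ^ 'n::finite ^ 'n"
  assumes c: "complementary_projection X Z P" and feas: "adjA A y + Z = C" and Zs: "Z \<in> sym_mats"
  obtains K where "0 < K"
    "\<And>u U. U \<in> psd_cone \<Longrightarrow> P ** U ** P = U \<Longrightarrow>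
      \<exists>v V. V \<in> psd_cone \<and> P ** V ** P = V \<and> adjA A v + V = C \<and>
        norm ((v, V) - (u, U)) \<le> K * norm (C - adjA A u - U) * (1 + norm ((y, Z) - (u, U)))"
proof -
  have P: "P \<in> sym_mats" "P ** P = P" "P ** Z ** P = Z"
    using c by (simp_all add: complementary_projection_def)
  obtain m where m: "0 < m" "Z - m *\<^sub>R P \<in> psd_cone"
    using c by (auto simp: complementary_projection_def)
  define T where "T w = adjA A (fst w) + snd w" for w :: "(real ^ 'm) \<times> (real ^ 'n ^ 'n)"
  define S :: "((real ^ 'm) \<times> (real ^ 'n ^ 'n)) set"
    where "S = {w. snd w \<in> sym_mats \<and> P ** snd w ** P = snd w}"
  have comp_lin: "P ** (a *\<^sub>R V + b *\<^sub>R W) ** P = a *\<^sub>R (P ** V ** P) + b *\<^sub>R (P ** W ** P)"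
    for a b V W
    by (simp add: matrix_eq mult_vec_simps matrix_vector_right_distrib
        flip: matrix_vector_mul_assoc)
  have linT: "linear T"
    unfolding T_def using linear_adjA[of A]
    by (intro linearI) (simp_all add: linear_add linear_scale algebra_simps)
  have subS: "subspace S"
    unfolding subspace_def S_def
    using comp_lin[of 1 _ 1] comp_lin[of _ _ 0] comp_lin[of 0 0 0 0]
    by (auto simp: sym_mats_closed)
  obtain g where g: "range g \<subseteq> S" "linear g" "\<And>v. v \<in> T ` S \<Longrightarrow> T (g v) = v"
    using linear_exists_right_inverse_on[OF linT subS] by blast
  obtain k where k: "0 < k" "\<And>v. norm (g v) \<le> k * norm v"
    using linear_bounded_pos[OF g(2)] by (auto simp: mult.commute)
  have main: "\<exists>v V. V \<in> psd_cone \<and> P ** V ** P = V \<and> adjA A v + V = C \<and>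
        norm ((v, V) - (u, U)) \<le> k * (1 + 1 / m) * norm (C - adjA A u - U) * (1 + norm ((y, Z) - (u, U)))"
    if U: "U \<in> psd_cone" "P ** U ** P = U" for u U
  proof -
    define R where "R = C - adjA A u - U"
    define d where "d = norm R"
    have d0: "0 \<le> d" by (simp add: d_def)
    have "(y, Z) - (u, U) \<in> S"
      using comp_lin[of 1 Z "-1" U] P U Zs psd_coneD(1)[OF U(1)] by (simp add: S_def sym_mats_closed)
    moreover have "T ((y, Z) - (u, U)) = R"
      using feas by (simp add: T_def R_def linear_diff[OF linear_adjA])
    ultimately have TR: "T (g R) = R" using g(3) by blast
    obtain w W where w: "g R = (w, W)" by (cases "g R")
    have W: "W \<in> sym_mats" "P ** W ** P = W" using range_subsetD[OF g(1), of R] w by (simp_all add: S_def)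
    have nw: "norm (w, W) \<le> k * d" using k(2)[of R] w by (simp add: d_def)
    have nW: "norm W \<le> k * d" using nw norm_snd_le[of W w] by simp
    have eqW: "adjA A w + W = R" using TR w by (simp add: T_def)
    \<comment> \<open>The weight \<open>t\<close> of \<open>(y, Z)\<close> solves \<open>(1 - t) * (k * d) = t * m\<close>: the gain from \<open>Z\<close> just offsets
      the worst possible loss from \<open>W\<close>.\<close>
    define t where "t = k * d / (m + k * d)"
    have den: "0 < m + k * d" using m(1) k(1) d0 by (simp add: add_pos_nonneg)
    have t: "0 \<le> t" "t \<le> 1" "(1 - t) * (k * d) = t * m" "t \<le> k * d / m"
      using den m(1) k(1) d0 by (simp_all add: t_def field_simps)
    define V where "V = (1 - t) *\<^sub>R (U + W) + t *\<^sub>R Z"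
    define v where "v = (1 - t) *\<^sub>R (u + w) + t *\<^sub>R y"
    have "V \<in> psd_cone"
      unfolding psd_cone_def
    proof (intro CollectI conjI allI)
      show "V \<in> sym_mats"
        unfolding V_def by (intro sym_mats_closed W Zs psd_coneD[OF U(1)])
      fix x
      define z where "z = (norm (P *v x))\<^sup>2"
      have "0 \<le> x \<bullet> ((Z - m *\<^sub>R P) *v x)" by (rule psd_coneD[OF m(2)])
      then have Zx: "m * z \<le> x \<bullet> (Z *v x)"
        by (simp add: mult_vec_simps inner_diff_right proj_quad_form[OF P(1,2)] z_def)
      have "\<bar>x \<bullet> (W *v x)\<bar> \<le> norm W * z"
        using quad_form_abs_le[of "P *v x" W]
        by (simp add: quad_form_compression[OF P(1), of x W, unfolded W(2)] z_def)
      also have "\<dots> \<le> k * d * z" using nW by (intro mult_right_mono) (simp_all add: z_def)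
      finally have Wx: "- (k * d * z) \<le> x \<bullet> (W *v x)" by linarith
      have Ux: "0 \<le> x \<bullet> (U *v x)" by (rule psd_coneD[OF U(1)])
      have "(1 - t) * (- (k * d * z)) \<le> (1 - t) * (x \<bullet> (U *v x) + x \<bullet> (W *v x))"
        using t Wx Ux by (intro mult_left_mono) linarith+
      moreover have "t * (m * z) \<le> t * (x \<bullet> (Z *v x))"
        using t Zx by (intro mult_left_mono)
      moreover have "(1 - t) * (- (k * d * z)) + t * (m * z) = 0"
      proof -
        have "(1 - t) * (- (k * d * z)) + t * (m * z) = t * m * z - (1 - t) * (k * d) * z"
          by (simp add: algebra_simps)
        then show ?thesis by (simp add: t(3))
      qed
      moreover have "x \<bullet> (V *v x) = (1 - t) * (x \<bullet> (U *v x) + x \<bullet> (W *v x)) + t * (x \<bullet> (Z *v x))"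
        by (simp add: V_def mult_vec_simps inner_add_right)
      ultimately show "0 \<le> x \<bullet> (V *v x)" by linarith
    qed
    moreover have "P ** V ** P = V"
      using comp_lin[of "1 - t" "U + W" t Z] comp_lin[of 1 U 1 W] U W P by (simp add: V_def)
    moreover have "adjA A v + V = C"
    proof -
      have "adjA A v + V = (1 - t) *\<^sub>R (adjA A u + U + (adjA A w + W)) + t *\<^sub>R (adjA A y + Z)"
        by (simp only: v_def V_def linear_add[OF linear_adjA] linear_scale[OF linear_adjA])
          (simp add: algebra_simps)
      also have "\<dots> = (1 - t) *\<^sub>R C + t *\<^sub>R C" by (simp add: eqW feas R_def)
      finally show ?thesis by (simp flip: scaleR_add_left)
    qed
    moreover have "norm ((v, V) - (u, U)) \<le> k * (1 + 1 / m) * d * (1 + norm ((y, Z) - (u, U)))"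
    proof -
      let ?n = "norm ((y, Z) - (u, U))"
      have "(v, V) - (u, U) = (1 - t) *\<^sub>R (w, W) + t *\<^sub>R ((y, Z) - (u, U))"
        by (simp add: v_def V_def algebra_simps)
      also have "norm \<dots> \<le> \<bar>1 - t\<bar> * norm (w, W) + \<bar>t\<bar> * ?n"
        by (rule norm_triangle_mono) (simp_all only: norm_scaleR order_refl)
      also have "\<dots> = (1 - t) * norm (w, W) + t * ?n" using t(1,2) by (simp only: abs_of_nonneg diff_ge_0_iff_ge)
      also have "\<dots> \<le> 1 * (k * d) + k * d / m * ?n"
        using t nw by (intro add_mono mult_mono) simp_all
      also have "\<dots> \<le> k * (1 + 1 / m) * d * (1 + ?n)"
      proof -
        have "0 \<le> k * d * ?n" "0 \<le> k * d / m" using k(1) d0 m(1) by simp_all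
        then show ?thesis by (simp add: algebra_simps)
      qed
      finally show ?thesis .
    qed
    ultimately show ?thesis unfolding d_def R_def by blast
  qed
  moreover have "0 < k * (1 + 1 / m)" using k(1) m(1) by (simp add: add_pos_pos)
  ultimately show ?thesis using that by blast
qed

section \<open>Quadratic growth on bounded sets\<close>

lemma sum3_power2_le: "((a :: real) + b + c)\<^sup>2 \<le> 3 * (a\<^sup>2 + b\<^sup>2 + c\<^sup>2)"
proof -
  have "0 \<le> (a - b)\<^sup>2 + (b - c)\<^sup>2 + (a - c)\<^sup>2" by simp
  then show ?thesis by (simp add: power2_eq_square algebra_simps)
qed

lemma strict_compl_tripleD:
  assumes "strong_duality A b C" and "dual_strict_compl_triple A b C X y Z"
  shows "X \<in> psd_cone" "opA A X = b" "dual_value A b C = ereal (C \<bullet> X)"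
    "Z \<in> psd_cone" "adjA A y + Z = C" "b \<bullet> y = C \<bullet> X" "\<exists>P. complementary_projection X Z P"
proof -
  show *: "X \<in> psd_cone" "opA A X = b" "dual_value A b C = ereal (C \<bullet> X)"
    using assms by (simp_all add: strong_duality_def dual_strict_compl_triple_def primal_solutions_def)
  show "Z \<in> psd_cone" "adjA A y + Z = C" "b \<bullet> y = C \<bullet> X"
    using assms *(3) by (simp_all add: dual_strict_compl_triple_def dual_solutions_def)
  then show "\<exists>P. complementary_projection X Z P"
    using strict_complementarity_projection[of Z X] assms(2)
    by (auto simp: dual_strict_compl_triple_def)
qed

text \<open>
  Weak duality with the residual kept: at an infeasible point the gap differs from the complementarity
  product \<open>X \<bullet> Z\<close> by \<open>X\<close> times the violation of the equation.
\<close>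
lemma duality_gap:
  assumes "opA A X = b"
  shows "C \<bullet> X - b \<bullet> y = X \<bullet> Z + X \<bullet> (C - adjA A y - Z)"
  using inner_adjA[of X A y] assms by (simp add: inner_diff_right inner_commute)

text \<open>
  Move from \<open>(u, U)\<close> to \<open>(u, W)\<close>, compress \<open>W\<close> into the face, and repair the equation there. The first
  and last steps cost terms linear in \<open>norm (U - W)\<close> and in the residual; the compression costs a
  multiple of \<open>sqrt (X \<bullet> W)\<close>. After squaring, the squares of the linear terms are again bounded by
  multiples of these terms, since everything is bounded. \<open>W\<close> is left free because the two growth
  inequalities call for different semidefinite approximations of \<open>U\<close>.
\<close>
lemma squared_distance_bound:
  fixes A :: "'m::finite \<Rightarrow> real ^ 'n::finite ^ 'n"
  assumes sd: "strong_duality A b C" and triple: "dual_strict_compl_triple A b C X y Z"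
    and B: "0 \<le> B"
  obtains K where "0 < K"
    "\<And>u U W. norm (u, U) \<le> B \<Longrightarrow> W \<in> psd_cone \<Longrightarrow> norm W \<le> B \<Longrightarrow>
      (infdist (u, U) (dual_solutions A b C))\<^sup>2
        \<le> K * (norm (C - adjA A u - U) + norm (U - W) + X \<bullet> W)"
proof -
  note tr = strict_compl_tripleD[OF sd triple]
  obtain P where c: "complementary_projection X Z P" using tr(7) by blast
  have P: "P \<in> sym_mats" "P ** P = P"
    using c by (simp_all add: complementary_projection_def)
  obtain K1 where K1: "0 < K1"
    "\<And>W. W \<in> psd_cone \<Longrightarrow> (norm (W - P ** W ** P))\<^sup>2 \<le> K1 * norm W * (X \<bullet> W)"
    using compression_error[OF c] by blast
  obtain K2 where K2: "0 < K2"
    "\<And>u U. U \<in> psd_cone \<Longrightarrow> P ** U ** P = U \<Longrightarrow>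
      \<exists>v V. V \<in> psd_cone \<and> P ** V ** P = V \<and> adjA A v + V = C \<and>
        norm ((v, V) - (u, U)) \<le> K2 * norm (C - adjA A u - U) * (1 + norm ((y, Z) - (u, U)))"
    using face_error_bound[OF c tr(5) psd_coneD(1)[OF tr(4)]] by blast
  obtain a where a: "0 < a" "\<And>u. norm (adjA A u) \<le> a * norm u"
    using linear_bounded_pos[OF linear_adjA] by (auto simp: mult.commute)
  define M where "M = norm (y, Z) + B + norm P * B * norm P"
  have M: "0 \<le> M" using B by (simp add: M_def)
  define L where "L = 1 + K2 * (1 + M)"
  have L: "1 \<le> L" using K2(1) M by (simp add: L_def)
  define N where "N = norm C + a * B + B + 2 * B + K1 * B + 1"
  have N: "0 < N" using a(1) B K1(1) unfolding N_def by (intro add_nonneg_pos add_nonneg_nonneg) simp_all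
  have "(infdist (u, U) (dual_solutions A b C))\<^sup>2
      \<le> 3 * L\<^sup>2 * N * (norm (C - adjA A u - U) + norm (U - W) + X \<bullet> W)"
    if uU: "norm (u, U) \<le> B" and W: "W \<in> psd_cone" "norm W \<le> B" for u U W
  proof -
    define r where "r = norm (C - adjA A u - U)"
    define e where "e = norm (U - W)"
    define s where "s = X \<bullet> W"
    define W' where "W' = P ** W ** P"
    define q where "q = norm (W - W')"
    have nn: "0 \<le> r" "0 \<le> e" "0 \<le> q" "0 \<le> s"
      using psd_inner_nonneg[OF tr(1) W(1)] by (simp_all add: r_def e_def q_def s_def)
    have nu: "norm u \<le> B" "norm U \<le> B"
      using uU norm_fst_le[of u U] norm_snd_le[of U u] by simp_all
    have W': "W' \<in> psd_cone" "P ** W' ** P = W'"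
      unfolding W'_def using psd_compression[OF P(1) W(1)]
      by (simp_all add: matrix_mul_assoc P(2)) (simp add: P(2) flip: matrix_mul_assoc)
    obtain v V where V: "V \<in> psd_cone" "P ** V ** P = V" "adjA A v + V = C"
      and dist: "norm ((v, V) - (u, W')) \<le> K2 * norm (C - adjA A u - W') * (1 + norm ((y, Z) - (u, W')))"
      using K2(2)[OF W', of u] by blast
    have "X \<bullet> V = 0" by (rule compressed_psd_inner_eq_0[OF c V(1,2)])
    moreover have "C - adjA A v - V = 0" using V(3) by (simp add: algebra_simps)
    ultimately have "b \<bullet> v = C \<bullet> X" using duality_gap[OF tr(2), of C v V] by simp
    then have mem: "(v, V) \<in> dual_solutions A b C"
      using V tr(3) by (simp add: dual_solutions_def)
    have "norm W' \<le> norm (P ** W) * norm P" unfolding W'_def by (rule norm_matrix_mult_le)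
    also have "\<dots> \<le> norm P * norm W * norm P" by (intro mult_right_mono norm_matrix_mult_le) simp
    also have "\<dots> \<le> norm P * B * norm P" using W(2) B by (intro mult_mono) simp_all
    finally have nW': "norm W' \<le> norm P * B * norm P" .
    have "norm ((y, Z) - (u, W')) \<le> norm (y, Z) + norm (u, W')" by (rule norm_triangle_ineq4)
    also have "norm (u, W') \<le> norm u + norm W'" by (rule norm_Pair_le)
    finally have nM: "norm ((y, Z) - (u, W')) \<le> M" using nu nW' by (simp add: M_def)
    have "C - adjA A u - W' = (C - adjA A u - U) + ((U - W) + (W - W'))" by simp
    then have res: "norm (C - adjA A u - W') \<le> r + (e + q)"
      unfolding r_def e_def q_def by (metis norm_triangle_ineq norm_triangle_mono order_refl)
    have "norm ((v, V) - (u, W')) \<le> K2 * (r + (e + q)) * (1 + M)"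
      using dist by (rule order_trans) (intro mult_mono res add_mono nM; use K2(1) nn in simp)
    moreover have "norm ((u, W') - (u, U)) \<le> e + q"
    proof -
      have "norm ((u, W') - (u, U)) = norm ((U - W) + (W - W'))"
        by (simp add: norm_minus_commute)
      then show ?thesis unfolding e_def q_def by (metis norm_triangle_ineq)
    qed
    moreover have "norm ((v, V) - (u, U)) \<le> norm ((v, V) - (u, W')) + norm ((u, W') - (u, U))"
      using norm_triangle_ineq[of "(v, V) - (u, W')" "(u, W') - (u, U)"] by simp
    ultimately have "norm ((v, V) - (u, U)) \<le> K2 * (r + (e + q)) * (1 + M) + (e + q)" by linarith
    also have "\<dots> \<le> L * (r + e + q)" using nn by (simp add: L_def algebra_simps)
    finally have "dist (u, U) (v, V) \<le> L * (r + e + q)"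
      by (simp only: dist_norm norm_minus_commute[of "(u, U)"])
    with infdist_le[OF mem] have "infdist (u, U) (dual_solutions A b C) \<le> L * (r + e + q)"
      by (rule order_trans)
    then have "(infdist (u, U) (dual_solutions A b C))\<^sup>2 \<le> L\<^sup>2 * (r + e + q)\<^sup>2"
      by (metis infdist_nonneg power_mono power_mult_distrib)
    also have "\<dots> \<le> L\<^sup>2 * (3 * (r\<^sup>2 + e\<^sup>2 + q\<^sup>2))"
      by (intro mult_left_mono sum3_power2_le) simp
    also have "\<dots> \<le> L\<^sup>2 * (3 * (N * (r + e + s)))"
    proof -
      have nnB: "0 \<le> K1 * B" "0 \<le> a * B" using K1(1) a(1) B by simp_all
      have "r \<le> norm C + norm (adjA A u) + norm U"
        unfolding r_def by (meson norm_triangle_ineq4 norm_triangle_mono order.trans order_refl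
            add_right_mono)
      also have "\<dots> \<le> norm C + a * B + B"
        using a(2)[of u] nu a(1) by (smt (verit) mult_left_mono)
      finally have rN: "r \<le> N" using nnB B by (simp add: N_def)
      have "e \<le> norm U + norm W" unfolding e_def by (rule norm_triangle_ineq4)
      then have eN: "e \<le> N" using nu W(2) nnB B norm_ge_zero[of C] unfolding N_def by linarith
      have "q\<^sup>2 \<le> K1 * norm W * s" unfolding q_def s_def W'_def by (rule K1(2)[OF W(1)])
      also have "\<dots> \<le> N * s"
      proof (intro mult_right_mono nn)
        have "K1 * norm W \<le> K1 * B" using K1(1) W(2) by simp
        also have "\<dots> \<le> N" using nnB B by (simp add: N_def)
        finally show "K1 * norm W \<le> N" .
      qed
      finally have "q\<^sup>2 \<le> N * s" .
      moreover have "r\<^sup>2 \<le> N * r" "e\<^sup>2 \<le> N * e"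
        using rN eN nn by (simp_all add: power2_eq_square mult_right_mono)
      ultimately have "r\<^sup>2 + e\<^sup>2 + q\<^sup>2 \<le> N * (r + e + s)" by (simp add: algebra_simps)
      then show ?thesis by (intro mult_left_mono) simp_all
    qed
    finally show ?thesis by (simp only: r_def e_def s_def mult_ac)
  qed
  moreover have "0 < 3 * L\<^sup>2 * N" using L N by simp
  ultimately show ?thesis using that by blast
qed

text \<open>
  The constant \<open>\<kappa>\<close> is small enough that \<open>\<kappa>\<close> times the right-hand side of the squared distance bound is
  paid for by \<open>X \<bullet> W\<close> itself and, through the margin \<open>\<rho> - trace X\<close>, by the part of the penalty that is
  not spent on replacing \<open>X \<bullet> U\<close> by \<open>X \<bullet> W\<close>; the residual is absorbed by \<open>\<gamma> = norm X + 1\<close>.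
\<close>
lemma quadratic_growth_on_bounded:
  fixes A :: "'m::finite \<Rightarrow> real ^ 'n::finite ^ 'n"
  assumes sd: "strong_duality A b C" and triple: "dual_strict_compl_triple A b C X y Z"
    and \<rho>: "trace X < \<rho>" and S: "bounded S" "S \<subseteq> UNIV \<times> sym_mats"
  obtains \<kappa> \<gamma> \<alpha> where "0 < \<kappa>" "0 < \<gamma>" "0 < \<alpha>"
    "\<And>u U. (u, U) \<in> S \<Longrightarrow> \<kappa> * (infdist (u, U) (dual_solutions A b C))\<^sup>2
        \<le> C \<bullet> X - b \<bullet> u + \<rho> * psd_defect U + \<gamma> * norm (C - adjA A u - U)"
    "\<And>u U. (u, U) \<in> S \<Longrightarrow> \<kappa> * (infdist (u, U) (dual_solutions A b C))\<^sup>2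
        \<le> C \<bullet> X - b \<bullet> u + \<gamma> * norm (C - adjA A u - U) + \<alpha> * infdist U psd_cone"
proof -
  note tr = strict_compl_tripleD[OF sd triple]
  define I where "I = norm (mat 1 :: real ^ 'n ^ 'n)"
  have I: "0 \<le> I" by (simp add: I_def)
  obtain B0 where B0: "0 < B0" "\<And>p. p \<in> S \<Longrightarrow> norm p \<le> B0"
    using S(1) by (auto simp: bounded_pos)
  \<comment> \<open>Large enough for the nearest semidefinite matrix and for the shift by a multiple of \<open>mat 1\<close>.\<close>
  define B where "B = 2 * B0 + B0 * I"
  have B: "0 \<le> B" using B0(1) I by (simp add: B_def)
  obtain K where K: "0 < K"
    "\<And>u U W. norm (u, U) \<le> B \<Longrightarrow> W \<in> psd_cone \<Longrightarrow> norm W \<le> B \<Longrightarrow>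
      (infdist (u, U) (dual_solutions A b C))\<^sup>2
        \<le> K * (norm (C - adjA A u - U) + norm (U - W) + X \<bullet> W)"
    using squared_distance_bound[OF sd triple B] by blast
  define \<kappa> where "\<kappa> = min 1 ((\<rho> - trace X) / (I + 1)) / K"
  have \<kappa>: "0 < \<kappa>" "\<kappa> * K \<le> 1" "\<kappa> * K * I \<le> \<rho> - trace X"
  proof -
    show "0 < \<kappa>" using K(1) \<rho> I by (simp add: \<kappa>_def)
    show "\<kappa> * K \<le> 1" using K(1) by (simp add: \<kappa>_def)
    have "\<kappa> * K * I \<le> (\<rho> - trace X) / (I + 1) * I"
      using K(1) I by (intro mult_right_mono) (simp_all add: \<kappa>_def)
    also have "\<dots> \<le> (\<rho> - trace X) / (I + 1) * (I + 1)"
      using I \<rho> by (intro mult_left_mono) simp_all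
    finally show "\<kappa> * K * I \<le> \<rho> - trace X" using I by simp
  qed
  define \<gamma> where "\<gamma> = norm X + 1"
  have \<gamma>: "0 < \<gamma>" by (simp add: \<gamma>_def add_nonneg_pos)
  \<comment> \<open>The common part of both inequalities: what remains to be covered for a semidefinite
    approximation \<open>W\<close> of \<open>U\<close> is \<open>X \<bullet> (W - U)\<close> and a small multiple of \<open>norm (U - W)\<close>.\<close>
  have key: "\<kappa> * (infdist (u, U) (dual_solutions A b C))\<^sup>2
        \<le> C \<bullet> X - b \<bullet> u + X \<bullet> (W - U) + \<gamma> * norm (C - adjA A u - U) + \<kappa> * K * norm (U - W)"
    if uU: "norm (u, U) \<le> B" and W: "W \<in> psd_cone" "norm W \<le> B" for u U W
  proof -
    define r where "r = norm (C - adjA A u - U)"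
    have s: "0 \<le> X \<bullet> W" by (rule psd_inner_nonneg[OF tr(1) W(1)])
    have "\<kappa> * (infdist (u, U) (dual_solutions A b C))\<^sup>2 \<le> \<kappa> * (K * (r + norm (U - W) + X \<bullet> W))"
      unfolding r_def using \<kappa>(1) K(2)[OF uU W] by (intro mult_left_mono) simp_all
    also have "\<dots> = (\<kappa> * K) * (r + X \<bullet> W) + \<kappa> * K * norm (U - W)" by (simp add: algebra_simps)
    also have "\<dots> \<le> 1 * (r + X \<bullet> W) + \<kappa> * K * norm (U - W)"
      using \<kappa>(2) s by (intro add_right_mono mult_right_mono) (simp_all add: r_def)
    also have "X \<bullet> W = C \<bullet> X - b \<bullet> u + X \<bullet> (W - U) - X \<bullet> (C - adjA A u - U)"
      using duality_gap[OF tr(2), of C u U] by (simp add: inner_diff_right)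
    also have "1 * (r + \<dots>) \<le> C \<bullet> X - b \<bullet> u + X \<bullet> (W - U) + \<gamma> * r"
      using Cauchy_Schwarz_ineq2[of X "C - adjA A u - U"] by (simp add: \<gamma>_def r_def algebra_simps)
    finally show ?thesis by (simp add: r_def)
  qed
  have S': "norm (u, U) \<le> B" "norm U \<le> B0" "U \<in> sym_mats" if "(u, U) \<in> S" for u U
    using B0(1) B0(2)[OF that] norm_snd_le[of U u] I S(2) that
    by (auto simp: B_def intro: add_increasing2 order_trans)
  have 1: "\<kappa> * (infdist (u, U) (dual_solutions A b C))\<^sup>2
        \<le> C \<bullet> X - b \<bullet> u + \<rho> * psd_defect U + \<gamma> * norm (C - adjA A u - U)" if "(u, U) \<in> S" for u U
  proof -
    define l where "l = psd_defect U"
    have l: "0 \<le> l" "l \<le> B0"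
      using psd_defect_nonneg[of U] psd_defect_le_norm[OF S'(3)[OF that]] S'(2)[OF that]
      by (simp_all add: l_def)
    let ?W = "U + l *\<^sub>R mat 1"
    have "norm ?W \<le> norm U + l * I"
      using norm_triangle_ineq[of U "l *\<^sub>R mat 1"] l by (simp add: I_def)
    also have "\<dots> \<le> B"
      using S'(2)[OF that] B0(1) mult_right_mono[OF l(2) I] by (simp add: B_def)
    finally have "\<kappa> * (infdist (u, U) (dual_solutions A b C))\<^sup>2
        \<le> C \<bullet> X - b \<bullet> u + X \<bullet> (?W - U) + \<gamma> * norm (C - adjA A u - U) + \<kappa> * K * norm (U - ?W)"
      using psd_defect_shift[OF S'(3)[OF that]] by (intro key S'(1)[OF that]) (simp_all add: l_def)
    moreover have "X \<bullet> (?W - U) = l * trace X"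
      by (simp add: trace_eq_inner[OF psd_coneD(1)[OF tr(1)]])
    moreover have "\<kappa> * K * norm (U - ?W) \<le> l * (\<rho> - trace X)"
      using mult_left_mono[OF \<kappa>(3) l(1)] l(1) by (simp add: I_def mult_ac)
    moreover have "l * trace X + l * (\<rho> - trace X) = \<rho> * l" by (simp add: algebra_simps)
    ultimately show ?thesis unfolding l_def[symmetric] by linarith
  qed
  have 2: "\<kappa> * (infdist (u, U) (dual_solutions A b C))\<^sup>2
        \<le> C \<bullet> X - b \<bullet> u + \<gamma> * norm (C - adjA A u - U) + \<gamma> * infdist U psd_cone"
    if "(u, U) \<in> S" for u U
  proof -
    have ne: "psd_cone \<noteq> ({} :: (real ^ 'n ^ 'n) set)" using tr(1) by blast
    obtain W where W: "W \<in> psd_cone" "infdist U psd_cone = dist U W"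
      using infdist_attains_inf[OF closed_psd_cone ne] by blast
    have "dist U W \<le> norm U"
      using infdist_le[OF psd_cone_closed_ops(3), of U] W(2) by simp
    then have "norm W \<le> B"
      using norm_triangle_ineq2[of W U] S'(2)[OF that] B0(1) I
      by (simp add: B_def dist_norm norm_minus_commute add_increasing2)
    from key[OF S'(1)[OF that] W(1) this]
    have "\<kappa> * (infdist (u, U) (dual_solutions A b C))\<^sup>2
        \<le> C \<bullet> X - b \<bullet> u + X \<bullet> (W - U) + \<gamma> * norm (C - adjA A u - U) + \<kappa> * K * norm (U - W)" .
    moreover have "X \<bullet> (W - U) \<le> norm X * norm (U - W)"
      using norm_cauchy_schwarz[of X "W - U"] by (simp add: norm_minus_commute)
    moreover have "\<kappa> * K * norm (U - W) \<le> 1 * norm (U - W)"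
      using \<kappa>(2) by (intro mult_right_mono) simp_all
    ultimately show ?thesis unfolding W(2) dist_norm \<gamma>_def by (simp add: algebra_simps)
  qed
  show ?thesis by (rule that[OF \<kappa>(1) \<gamma> \<gamma> 1 2])
qed

section \<open>Boundedness of sublevel sets\<close>

text \<open>
  Convexity of the defect along segments that start in the cone, where the defect vanishes.
\<close>
lemma psd_defect_segment:
  assumes Z: "Z \<in> psd_cone" and W: "W \<in> sym_mats" and t: "0 \<le> t" "t \<le> 1"
  shows "psd_defect (Z + t *\<^sub>R (W - Z)) \<le> t * psd_defect W"
proof (rule psd_defect_le)
  show "Z + t *\<^sub>R (W - Z) \<in> sym_mats" by (intro sym_mats_closed W psd_coneD[OF Z])
  show "0 \<le> t * psd_defect W" using t(1) psd_defect_nonneg[of W] by simp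
  have "(1 - t) *\<^sub>R Z + t *\<^sub>R (W + psd_defect W *\<^sub>R mat 1) \<in> psd_cone"
    using t by (intro psd_cone_closed_ops Z psd_defect_shift W) simp_all
  then show "Z + t *\<^sub>R (W - Z) + (t * psd_defect W) *\<^sub>R mat 1 \<in> psd_cone"
    by (simp add: algebra_simps)
qed

text \<open>
  Let all dual solutions lie within \<open>r\<close> of \<open>(y, Z)\<close>. A point at distance \<open>r + 1\<close> that satisfies
  the linear equation is at distance at least \<open>1\<close> from the solutions, so by quadratic growth its objective exceeds the optimum by at
  least \<open>\<kappa>\<close>. Convexity along the segment from \<open>(y, Z)\<close> turns this into an excess of at least
  \<open>\<kappa> * l / (r + 1)\<close> at distance \<open>l > r + 1\<close>.
\<close>
lemma bounded_penalty_sublevel: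
  fixes A :: "'m::finite \<Rightarrow> real ^ 'n::finite ^ 'n"
  assumes sd: "strong_duality A b C" and triple: "dual_strict_compl_triple A b C X y Z"
    and \<rho>: "trace X < \<rho>" and bdd: "bounded (dual_solutions A b C)"
  shows "bounded {(u, U). U \<in> sym_mats \<and> \<rho> * psd_defect U - b \<bullet> u \<le> \<beta> \<and> adjA A u + U = C}"
    (is "bounded ?S")
proof -
  note tr = strict_compl_tripleD[OF sd triple]
  have Zs: "Z \<in> sym_mats" by (rule psd_coneD[OF tr(4)])
  have "0 \<le> trace X"
    using trace_eq_inner[OF psd_coneD(1)[OF tr(1)]] psd_inner_nonneg[OF tr(1) psd_cone_closed_ops(4)]
    by simp
  then have \<rho>0: "0 < \<rho>" using \<rho> by simp
  obtain r where r: "0 < r" "\<And>p. p \<in> dual_solutions A b C \<Longrightarrow> dist (y, Z) p \<le> r"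
  proof -
    obtain e where "\<forall>p\<in>dual_solutions A b C. dist (y, Z) p \<le> e"
      using bdd bounded_any_center[of _ "(y, Z)"] by blast
    then show ?thesis by (intro that[of "max 1 e"]) (auto simp: le_max_iff_disj)
  qed
  let ?B = "cball (y, Z) (r + 1) \<inter> UNIV \<times> sym_mats"
  have B: "bounded ?B" by (simp add: bounded_Int)
  obtain \<kappa> \<gamma> where \<kappa>: "0 < \<kappa>"
    and growth: "\<And>u U. (u, U) \<in> ?B \<Longrightarrow> \<kappa> * (infdist (u, U) (dual_solutions A b C))\<^sup>2
        \<le> C \<bullet> X - b \<bullet> u + \<rho> * psd_defect U + \<gamma> * norm (C - adjA A u - U)"
    by (rule quadratic_growth_on_bounded[OF sd triple \<rho> B]) (blast, rule that)
  have ne: "dual_solutions A b C \<noteq> {}"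
    using triple by (auto simp: dual_strict_compl_triple_def)
  have "dist (y, Z) p \<le> max (r + 1) ((r + 1) * (\<beta> + C \<bullet> X) / \<kappa>)" if p: "p \<in> ?S" for p
  proof (cases "dist (y, Z) p \<le> r + 1")
    case False
    define l where "l = dist (y, Z) p"
    define t where "t = (r + 1) / l"
    have l: "r + 1 < l" using False by (simp add: l_def)
    have t: "0 < t" "t \<le> 1" "t * l = r + 1" using l r(1) by (simp_all add: t_def)
    obtain u U where pu: "p = (u, U)" and U: "U \<in> sym_mats" "\<rho> * psd_defect U - b \<bullet> u \<le> \<beta>"
      "adjA A u + U = C"
      using p by blast
    define u' where "u' = y + t *\<^sub>R (u - y)"
    define U' where "U' = Z + t *\<^sub>R (U - Z)"
    have U's: "U' \<in> sym_mats" unfolding U'_def by (intro sym_mats_closed Zs U)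
    have eqp: "(u', U') = (y, Z) + t *\<^sub>R (p - (y, Z))" by (simp add: u'_def U'_def pu)
    have dq: "dist (y, Z) (u', U') = r + 1"
      unfolding eqp using t by (simp add: dist_norm l_def norm_minus_commute)
    have "1 \<le> infdist (u', U') (dual_solutions A b C)"
      unfolding infdist_notempty[OF ne]
    proof (rule cINF_greatest[OF ne])
      fix q assume "q \<in> dual_solutions A b C"
      then show "1 \<le> dist (u', U') q"
        using r(2)[of q] dq dist_triangle[of "(y, Z)" "(u', U')" q]
        by (smt (verit) dist_commute dist_triangle)
    qed
    then have "\<kappa> * 1 \<le> \<kappa> * (infdist (u', U') (dual_solutions A b C))\<^sup>2"
      using \<kappa> by (intro mult_left_mono) (simp_all add: one_le_power)
    also have "\<dots> \<le> C \<bullet> X - b \<bullet> u' + \<rho> * psd_defect U' + \<gamma> * norm (C - adjA A u' - U')"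
      using dq U's by (intro growth) simp
    also have "C - adjA A u' - U' = (C - (adjA A y + Z)) - t *\<^sub>R ((adjA A u + U) - (adjA A y + Z))"
      by (simp only: u'_def U'_def linear_add[OF linear_adjA] linear_diff[OF linear_adjA]
          linear_scale[OF linear_adjA]) (simp add: algebra_simps)
    also have "\<dots> = 0" by (simp add: U(3) tr(5))
    also have "b \<bullet> u' = C \<bullet> X + t * (b \<bullet> u - C \<bullet> X)"
      by (simp add: u'_def inner_add_right inner_diff_right tr(6))
    also have "\<rho> * psd_defect U' \<le> \<rho> * (t * psd_defect U)"
      unfolding U'_def using \<rho>0 t by (intro mult_left_mono psd_defect_segment tr(4) U(1)) simp_all
    finally have "\<kappa> \<le> t * (\<rho> * psd_defect U - b \<bullet> u + C \<bullet> X)" by (simp add: algebra_simps)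
    also have "\<dots> \<le> t * (\<beta> + C \<bullet> X)" using U(2) t by (intro mult_left_mono) simp_all
    finally have "\<kappa> * l \<le> (r + 1) * (\<beta> + C \<bullet> X)"
      using l r(1) by (simp add: t_def field_simps)
    then have "l \<le> (r + 1) * (\<beta> + C \<bullet> X) / \<kappa>" using \<kappa> by (simp add: field_simps)
    then show ?thesis by (simp add: l_def)
  qed simp
  then show ?thesis unfolding bounded_def by (intro exI ballI)
qed

section \<open>Growth of the dual objective\<close>

lemma exact_penalty_le_indicator: "exact_penalty \<rho> U \<le> indicator_fun psd_cone U"
  using psd_defect_eq_0[of U]
  by (simp add: exact_penalty_def indicator_fun_def psd_defect_def zero_ereal_def)

theorem theorem2:
  fixes A :: "'m::finite \<Rightarrow> real ^ 'n::finite ^ 'n"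
    and b :: "real ^ 'm"
    and C :: "real ^ 'n ^ 'n"
    and Xbar Zbar :: "real ^ 'n ^ 'n"
    and ybar :: "real ^ 'm"
    and h :: "real ^ 'n ^ 'n \<Rightarrow> ereal"
  assumes C_sym: "C \<in> sym_mats"
    and A_sym: "\<And>i. A i \<in> sym_mats"
    and A_surj: "opA A ` sym_mats = UNIV"
    and sd: "strong_duality A b C"
    and dsc: "dual_strict_complementarity A b C"
    and triple: "dual_strict_compl_triple A b C Xbar ybar Zbar"
    and h: "h = indicator_fun psd_cone \<or> (\<exists>\<rho>. \<rho> > trace Xbar \<and> h = exact_penalty \<rho>)"
  shows
    "(\<forall>V. V \<subseteq> UNIV \<times> sym_mats \<and> compact V \<and> V \<inter> dual_solutions A b C \<noteq> {} \<longrightarrow>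
       (\<exists>\<kappa>>0. \<exists>\<gamma>>0. \<exists>\<alpha>>0.
         (\<forall>(y, Z)\<in>V.
            dual_objective b h y Z - (- dual_value A b C) + ereal (\<gamma> * norm (C - adjA A y - Z))
              \<ge> ereal (\<kappa> * (infdist (y, Z) (dual_solutions A b C))\<^sup>2)) \<and>
         (\<forall>(y, Z)\<in>V.
            dual_value A b C - ereal (b \<bullet> y) + ereal (\<gamma> * norm (C - adjA A y - Z))
                + ereal (\<alpha> * infdist Z psd_cone)
              \<ge> ereal (\<kappa> * (infdist (y, Z) (dual_solutions A b C))\<^sup>2)))) \<and>
     (compact (dual_solutions A b C) \<longrightarrow>
       (\<forall>(\<beta>::real) V.
          V = {(y, Z). Z \<in> sym_mats \<and> dual_objective b h y Z \<le> ereal \<beta> \<and> adjA A y + Z = C} \<longrightarrow>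
       (\<exists>\<kappa>>0. \<exists>\<gamma>>0. \<exists>\<alpha>>0.
         (\<forall>(y, Z)\<in>V.
            dual_objective b h y Z - (- dual_value A b C) + ereal (\<gamma> * norm (C - adjA A y - Z))
              \<ge> ereal (\<kappa> * (infdist (y, Z) (dual_solutions A b C))\<^sup>2)) \<and>
         (\<forall>(y, Z)\<in>V.
            dual_value A b C - ereal (b \<bullet> y) + ereal (\<gamma> * norm (C - adjA A y - Z))
                + ereal (\<alpha> * infdist Z psd_cone)
              \<ge> ereal (\<kappa> * (infdist (y, Z) (dual_solutions A b C))\<^sup>2)))))"
proof -
  note tr = strict_compl_tripleD[OF sd triple]
  \<comment> \<open>The indicator function dominates every exact penalty, so a lower bound for a penalty serves for both
    choices of \<open>h\<close>.\<close>
  obtain \<rho> where \<rho>: "trace Xbar < \<rho>" and pen: "\<And>U. exact_penalty \<rho> U \<le> h U"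
  proof -
    from h show ?thesis
    proof
      assume "h = indicator_fun psd_cone"
      then show ?thesis using exact_penalty_le_indicator by (intro that[of "trace Xbar + 1"]) auto
    next
      assume "\<exists>\<rho>. \<rho> > trace Xbar \<and> h = exact_penalty \<rho>"
      then show ?thesis using that by blast
    qed
  qed
  have obj: "ereal (\<rho> * psd_defect U - b \<bullet> u) \<le> dual_objective b h u U" for u U
  proof -
    have "ereal (- (b \<bullet> u)) + exact_penalty \<rho> U \<le> dual_objective b h u U"
      unfolding dual_objective_def by (intro add_left_mono pen)
    then show ?thesis by (simp add: exact_penalty_def psd_defect_def)
  qed
  have growth: "\<exists>\<kappa>>0. \<exists>\<gamma>>0. \<exists>\<alpha>>0.
         (\<forall>(y, Z)\<in>V.
            dual_objective b h y Z - (- dual_value A b C) + ereal (\<gamma> * norm (C - adjA A y - Z))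
              \<ge> ereal (\<kappa> * (infdist (y, Z) (dual_solutions A b C))\<^sup>2)) \<and>
         (\<forall>(y, Z)\<in>V.
            dual_value A b C - ereal (b \<bullet> y) + ereal (\<gamma> * norm (C - adjA A y - Z))
                + ereal (\<alpha> * infdist Z psd_cone)
              \<ge> ereal (\<kappa> * (infdist (y, Z) (dual_solutions A b C))\<^sup>2))"
    if V: "bounded V" "V \<subseteq> UNIV \<times> sym_mats" for V
  proof -
    obtain \<kappa> \<gamma> \<alpha> where pos: "0 < \<kappa>" "0 < \<gamma>" "0 < \<alpha>"
      and 1: "\<And>u U. (u, U) \<in> V \<Longrightarrow> \<kappa> * (infdist (u, U) (dual_solutions A b C))\<^sup>2
        \<le> C \<bullet> Xbar - b \<bullet> u + \<rho> * psd_defect U + \<gamma> * norm (C - adjA A u - U)"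
      and 2: "\<And>u U. (u, U) \<in> V \<Longrightarrow> \<kappa> * (infdist (u, U) (dual_solutions A b C))\<^sup>2
        \<le> C \<bullet> Xbar - b \<bullet> u + \<gamma> * norm (C - adjA A u - U) + \<alpha> * infdist U psd_cone"
      using quadratic_growth_on_bounded[OF sd triple \<rho> V] by blast
    have "ereal (\<kappa> * (infdist (u, U) (dual_solutions A b C))\<^sup>2)
        \<le> dual_objective b h u U - (- dual_value A b C) + ereal (\<gamma> * norm (C - adjA A u - U))"
      if "(u, U) \<in> V" for u U
    proof -
      have "ereal (\<kappa> * (infdist (u, U) (dual_solutions A b C))\<^sup>2)
          \<le> ereal (\<rho> * psd_defect U - b \<bullet> u) + ereal (C \<bullet> Xbar) + ereal (\<gamma> * norm (C - adjA A u - U))"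
        using 1[OF that] by simp
      also have "\<dots> \<le> dual_objective b h u U + ereal (C \<bullet> Xbar) + ereal (\<gamma> * norm (C - adjA A u - U))"
        by (intro add_right_mono obj)
      finally show ?thesis by (simp add: tr(3) minus_ereal_def)
    qed
    then show ?thesis using pos 2 by (intro exI[of _ \<kappa>] exI[of _ \<gamma>] exI[of _ \<alpha>] conjI) (auto simp: tr(3))
  qed
  have sublevel: "bounded {(y, Z). Z \<in> sym_mats \<and> dual_objective b h y Z \<le> ereal \<beta> \<and> adjA A y + Z = C}"
    if "compact (dual_solutions A b C)" for \<beta>
  proof (rule bounded_subset)
    show "bounded {(u, U). U \<in> sym_mats \<and> \<rho> * psd_defect U - b \<bullet> u \<le> \<beta> \<and> adjA A u + U = C}"
      by (rule bounded_penalty_sublevel[OF sd triple \<rho> compact_imp_bounded[OF that]])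
    show "{(y, Z). Z \<in> sym_mats \<and> dual_objective b h y Z \<le> ereal \<beta> \<and> adjA A y + Z = C}
      \<subseteq> {(u, U). U \<in> sym_mats \<and> \<rho> * psd_defect U - b \<bullet> u \<le> \<beta> \<and> adjA A u + U = C}"
      using obj order_trans by fastforce
  qed
  show ?thesis
  proof (intro conjI allI impI, goal_cases)
    case (1 V)
    then show ?case by (intro growth compact_imp_bounded) blast+
  next
    case (2 \<beta> V)
    show ?case unfolding 2(2) by (rule growth[OF sublevel[OF 2(1)]]) blast
  qed
qed

end
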